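(* There exists a finitely generated torsion-free group $\Gamma$ of intermediate growth whose center $Z(\Gamma)$ is isomorphic to $\mathbb{Z}^{\infty}$.
   Context: $\mathbb{Z}^{\infty}$ denotes the direct sum of countably infinitely many copies of $\mathbb{Z}$. For a group $G$ with finite generating set $S$, $v_{G,S}(n)$ is the number of elements of word length at most $n$. $G$ is of intermediate growth if $\lim_{n\to\infty} v_{G,S}(n)^{1/n}=1$ and $v_{G,S}$ is not bounded above by any polynomial. *)

theory Defs
  imports
    Complex_Main
    "HOL-Algebra.Generated_Groups"
    "HOL-Algebra.Elementary_Groups"
    "HOL-Algebra.Product_Groups"
    "HOL-Computational_Algebra.Polynomial"
begin

definition generating_set :: "('a, 'b) monoid_scheme \<Rightarrow> 'a set \<Rightarrow> bool" where
  "generating_set G S \<longleftrightarrow> S \<subseteq> carrier G \<and> generate G S = carrier G"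

definition finitely_generated :: "('a, 'b) monoid_scheme \<Rightarrow> bool" where
  "finitely_generated G \<longleftrightarrow> (\<exists>S. finite S \<and> generating_set G S)"

definition torsion_free :: "('a, 'b) monoid_scheme \<Rightarrow> bool" where
  "torsion_free G \<longleftrightarrow>
     (\<forall>x \<in> carrier G. \<forall>n::nat. n > 0 \<and> x [^]\<^bsub>G\<^esub> n = \<one>\<^bsub>G\<^esub> \<longrightarrow> x = \<one>\<^bsub>G\<^esub>)"

definition center :: "('a, 'b) monoid_scheme \<Rightarrow> 'a set" where
  "center G = {z \<in> carrier G. \<forall>g \<in> carrier G. z \<otimes>\<^bsub>G\<^esub> g = g \<otimes>\<^bsub>G\<^esub> z}"

definition center_group :: "('a, 'b) monoid_scheme \<Rightarrow> ('a, 'b) monoid_scheme" where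
  "center_group G = G\<lparr>carrier := center G\<rparr>"

text \<open>Words are over \<open>S\<close> and the inverses of its elements; \<open>S\<close> itself need not be symmetric.
  For elements outside the subgroup generated by \<open>S\<close> the value is unspecified.\<close>

definition word_length :: "('a, 'b) monoid_scheme \<Rightarrow> 'a set \<Rightarrow> 'a \<Rightarrow> nat" where
  "word_length G S g =
     (LEAST k. \<exists>ws. length ws = k \<and> set ws \<subseteq> S \<union> m_inv G ` S \<and>
        foldr (monoid.mult G) ws \<one>\<^bsub>G\<^esub> = g)"

definition growth :: "('a, 'b) monoid_scheme \<Rightarrow> 'a set \<Rightarrow> nat \<Rightarrow> nat" where
  "growth G S n = card {g \<in> carrier G. word_length G S g \<le> n}"

text \<open>Neither growth condition depends on the choice of the finite generating set \<open>S\<close>.\<close>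

definition intermediate_growth :: "('a, 'b) monoid_scheme \<Rightarrow> bool" where
  "intermediate_growth G \<longleftrightarrow>
     (\<exists>S. finite S \<and> generating_set G S \<and>
        (\<lambda>n. root n (real (growth G S n))) \<longlonglongrightarrow> 1 \<and>
        \<not> (\<exists>p :: real poly. \<forall>n. real (growth G S n) \<le> poly p (real n)))"

definition Z_infinity :: "(nat \<Rightarrow> int) monoid" where
  "Z_infinity = sum_group UNIV (\<lambda>_. integer_group)"

end

theory Submission
  imports Defs "HOL-Library.Countable_Set"
begin

text \<open>
  Decorate the vertices of the binary tree with elements of a torsion-free nilpotent group \<open>H\<close> of
  class two that acts on the two subtrees below a vertex through a parity homomorphism. The group of
  all decorations is torsion-free, because the root label of a torsion element vanishes, and then one
  descends to the subtrees. Its subgroup \<open>Gam\<close>, generated by the root copy of \<open>H\<close> and a directed copy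
  of \<open>H\<close>, is a torsion-free analogue of Grigorchuk's group: \<open>directed h\<close> has components \<open>rooted h\<close> and
  \<open>directed (rot h)\<close>, where \<open>rot\<close> is an automorphism of order three that permutes the nontrivial
  elements of the Klein four quotient of \<open>H\<close>.

  A decoration commuting with \<open>Gam\<close> is constant on levels with values in the center \<open>\<int>\<close> of \<open>H\<close>, and
  an element of \<open>Gam\<close> has a bounded number of nontrivial labels on each level, so central elements are
  supported on finitely many levels. Conversely, commutators of directed elements whose rays have a
  common prefix have finite support, which yields every finitely supported level-constant central
  decoration; hence the center is the direct sum of copies of \<open>\<int>\<close>, and in particular the growth is not
  polynomial.

  For the upper bound, the number of syllables of an alternating word, weighted by their classes in
  the Klein four group, contracts by the factor \<open>8 / 9\<close> in passing to the two components, while the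
  total norm of the syllables does not grow. As \<open>H\<close> has polynomial growth, a word of total norm \<open>m\<close>
  with \<open>\<epsilon> m\<close> syllables takes at most \<open>exp (o(1) m)\<close> values as \<open>\<epsilon>\<close> tends to zero.
\<close>

section \<open>The nilpotent group of labels and its automorphism of order three\<close>

datatype heis = Heis int int int int int

instance heis :: countable
  by countable_datatype

instantiation heis :: group_add
begin

definition zero_heis :: heis where
  "0 = Heis 0 0 0 0 0"

fun plus_heis :: "heis \<Rightarrow> heis \<Rightarrow> heis" where
  "Heis x y u v z + Heis x' y' u' v' z' =
     Heis (x + x') (y + y') (u + u') (v + v') (z + z' + (x * y' - x' * y) + u * v')"

fun uminus_heis :: "heis \<Rightarrow> heis" where
  "- Heis x y u v z = Heis (- x) (- y) (- u) (- v) (u * v - z)"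

definition minus_heis :: "heis \<Rightarrow> heis \<Rightarrow> heis" where
  "a - b = a + - b" for a b :: heis

instance
proof
  fix a b c :: heis
  show "a + b + c = a + (b + c)"
    by (cases a; cases b; cases c) (simp add: algebra_simps)
  show "0 + a = a" "a + 0 = a" "- a + a = 0"
    by (cases a; simp add: zero_heis_def algebra_simps)+
  show "a + - b = a - b"
    by (simp add: minus_heis_def)
qed

end

fun parity :: "heis \<Rightarrow> bool" where
  "parity (Heis x y u v z) \<longleftrightarrow> odd (x + y)"

lemma parity_zero [simp]: "\<not> parity 0"
  by (simp add: zero_heis_def)

lemma parity_add [simp]: "parity (a + b) \<longleftrightarrow> parity a \<noteq> parity b"
  by (cases a; cases b) auto

lemma parity_uminus [simp]: "parity (- a) \<longleftrightarrow> parity a"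
  by (cases a) auto

text \<open>The cocycle pairs \<open>x\<close>, \<open>y\<close> symplectically so that \<open>rot\<close> is an automorphism; \<open>u\<close> and \<open>v\<close> are
  fixed by \<open>rot\<close> and generate the whole center by their commutator, while having even parity.\<close>

fun rot :: "heis \<Rightarrow> heis" where
  "rot (Heis x y u v z) = Heis (- y) (x - y) u v z"

lemma rot_zero [simp]: "rot 0 = 0"
  by (simp add: zero_heis_def)

lemma rot_add: "rot (a + b) = rot a + rot b"
  by (cases a; cases b) (simp add: algebra_simps)

lemma rot_rot_rot [simp]: "rot (rot (rot h)) = h"
  by (cases h) auto

section \<open>The group of decorations of the binary tree\<close>

codatatype portrait = Node (lab: heis) (sub: "bool \<Rightarrow> portrait")

lemma portrait_coinduct_sub [consumes 1, case_names lab sub]: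
  assumes "R g h"
    and "\<And>g h. R g h \<Longrightarrow> lab g = lab h"
    and "\<And>g h c. R g h \<Longrightarrow> R (sub g c) (sub h c)"
  shows "g = h"
  using assms(1) by (coinduction arbitrary: g h) (auto simp: rel_fun_def assms)

lemma portrait_eqI:
  assumes "lab g = lab h" "\<And>c. sub g c = sub h c"
  shows "g = h"
  using assms by (auto intro: portrait.expand)

instantiation portrait :: group_add
begin

primcorec zero_portrait :: portrait where
  "lab 0 = 0"
| "sub 0 = (\<lambda>c. 0)"

text \<open>This is the infinitely iterated permutational wreath product of \<open>heis\<close>. The
  right summand acts first, so the component of \<open>g\<close> is taken at the image of
  \<open>c\<close> under \<open>h\<close>.\<close>

primcorec plus_portrait :: "portrait \<Rightarrow> portrait \<Rightarrow> portrait" where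
  "lab (g + h) = lab g + lab h"
| "sub (g + h) = (\<lambda>c. sub g (c \<noteq> parity (lab h)) + sub h c)"

primcorec uminus_portrait :: "portrait \<Rightarrow> portrait" where
  "lab (- g) = - lab g"
| "sub (- g) = (\<lambda>c. - sub g (c \<noteq> parity (lab g)))"

definition minus_portrait :: "portrait \<Rightarrow> portrait \<Rightarrow> portrait" where
  "g - h = g + - h" for g h :: portrait

instance
proof
  fix a b c :: portrait
  show "a + b + c = a + (b + c)"
  proof (rule portrait_coinduct_sub [of "\<lambda>g h. \<exists>a b c. g = a + b + c \<and> h = a + (b + c)"])
    fix g h :: portrait and k
    assume "\<exists>a b c. g = a + b + c \<and> h = a + (b + c)"
    then obtain a b c :: portrait where gh: "g = a + b + c" "h = a + (b + c)" by blast
    have "((k \<noteq> parity (lab c)) \<noteq> parity (lab b)) = (k \<noteq> (parity (lab b) \<noteq> parity (lab c)))" by blast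
    then show "\<exists>a b c. sub g k = a + b + c \<and> sub h k = a + (b + c)"
      unfolding gh plus_portrait.sel parity_add by (simp only:) blast
  qed (auto simp: add.assoc)
  show "0 + a = a"
    by (coinduction arbitrary: a rule: portrait_coinduct_sub) auto
  show "a + 0 = a"
    by (coinduction arbitrary: a rule: portrait_coinduct_sub) auto
  have "((k = (\<not> p)) = (\<not> p)) = k" for k p by blast
  then show "- a + a = 0"
    by (coinduction arbitrary: a rule: portrait_coinduct_sub) auto
  show "a + - b = a - b"
    by (simp add: minus_portrait_def)
qed

end

lemma lab_diff [simp]: "lab (g - h) = lab g - lab h"
  by (simp only: minus_portrait_def plus_portrait.sel uminus_portrait.sel minus_heis_def)

lemma sub_diff [simp]:
  "sub (g - h) c = sub g (c \<noteq> parity (lab h)) - sub h (c \<noteq> parity (lab h))"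
  by (simp only: minus_portrait_def plus_portrait.sel uminus_portrait.sel parity_uminus)

section \<open>Rooted and directed elements and the group they generate\<close>

definition rooted :: "heis \<Rightarrow> portrait" where
  "rooted h = Node h (\<lambda>c. 0)"

primcorec directed :: "heis \<Rightarrow> portrait" where
  "lab (directed h) = 0"
| "sub (directed h) = (\<lambda>c. if c then directed (rot h) else rooted h)"

lemma lab_rooted [simp]: "lab (rooted h) = h"
  and sub_rooted [simp]: "sub (rooted h) c = 0"
  by (simp_all add: rooted_def)

lemma rooted_zero [simp]: "rooted 0 = 0"
  by (rule portrait_eqI) auto

lemma rooted_add: "rooted (a + b) = rooted a + rooted b"
  by (rule portrait_eqI) auto

lemma rooted_uminus: "rooted (- a) = - rooted a"
  by (rule portrait_eqI) auto

lemma directed_zero [simp]: "directed 0 = 0"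
proof -
  \<comment> \<open>The second disjunct closes the relation under components: off the ray they are
    \<open>rooted 0\<close>, which is already \<open>0\<close>.\<close>
  have "\<exists>h. g = directed 0 \<and> h = 0 \<or> g = 0 \<and> h = 0 \<Longrightarrow> g = 0" for g
    by (coinduction arbitrary: g rule: portrait_coinduct_sub) auto
  then show ?thesis by blast
qed

lemma directed_add: "directed (a + b) = directed a + directed b"
proof -
  have "(\<exists>a b. g = directed (a + b) \<and> h = directed a + directed b) \<or> g = h \<Longrightarrow> g = h" for g h
    by (coinduction arbitrary: g h rule: portrait_coinduct_sub) (auto simp: rooted_add rot_add, blast)
  then show ?thesis by blast
qed

lemma directed_uminus: "directed (- a) = - directed a"
  by (metis add.left_inverse eq_neg_iff_add_eq_0 directed_add directed_zero)

definition pair :: "portrait \<Rightarrow> portrait \<Rightarrow> portrait" where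
  "pair g h = Node 0 (\<lambda>c. if c then h else g)"

lemma lab_pair [simp]: "lab (pair g h) = 0"
  and sub_pair [simp]: "sub (pair g h) c = (if c then h else g)"
  by (simp_all add: pair_def)

lemma pair_add: "pair g h + pair g' h' = pair (g + g') (h + h')"
  by (rule portrait_eqI) auto

lemma pair_uminus: "- pair g h = pair (- g) (- h)"
  by (rule portrait_eqI) auto

text \<open>These are the conjugates of \<open>directed h\<close> by rooted elements, one for each
  parity; \<open>e\<close> marks the component that holds the rooted element.\<close>

definition twisted :: "bool \<Rightarrow> heis \<Rightarrow> portrait" where
  "twisted e h = Node 0 (\<lambda>c. if c = e then rooted h else directed (rot h))"

lemma lab_twisted [simp]: "lab (twisted e h) = 0"
  and sub_twisted [simp]: "sub (twisted e h) c = (if c = e then rooted h else directed (rot h))"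
  by (simp_all add: twisted_def)

lemma twisted_False: "twisted False h = directed h"
  by (rule portrait_eqI) auto

lemma twisted_add: "twisted e (a + b) = twisted e a + twisted e b"
  by (rule portrait_eqI) (auto simp: rooted_add directed_add rot_add)

text \<open>The components of \<open>rooted h\<close> vanish, so conjugation by it only permutes the
  two components, and only through the parity of \<open>h\<close>.\<close>

lemma rooted_twisted: "rooted h + twisted e x = twisted (e \<noteq> parity h) x + rooted h"
  by (rule portrait_eqI) auto

lemma twisted_conj: "twisted (e \<noteq> parity h) x = rooted h + twisted e x - rooted h"
  by (simp add: rooted_twisted)

primrec letter :: "bool \<times> heis \<Rightarrow> portrait" where
  "letter (b, h) = (if b then directed h else rooted h)"

abbreviation eval_word :: "(bool \<times> heis) list \<Rightarrow> portrait" where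
  "eval_word ws \<equiv> sum_list (map letter ws)"

text \<open>Words without formal inverses already form a group, since the inverse of a letter is a
  letter.\<close>

definition Gam :: "portrait set" where
  "Gam = range eval_word"

lemma letter_uminus: "- letter (b, h) = letter (b, - h)"
  by (simp add: directed_uminus rooted_uminus)

lemma Gam_zero [simp]: "0 \<in> Gam"
  unfolding Gam_def by (rule range_eqI [of _ _ "[]"]) simp

lemma Gam_add: "g \<in> Gam \<Longrightarrow> h \<in> Gam \<Longrightarrow> g + h \<in> Gam"
  unfolding Gam_def by (auto simp: image_iff) (metis map_append sum_list.append)

lemma Gam_letter: "letter l \<in> Gam"
  unfolding Gam_def by (rule range_eqI [of _ _ "[l]"]) simp

lemma Gam_rooted: "rooted h \<in> Gam" and Gam_directed: "directed h \<in> Gam"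
  using Gam_letter [of "(False, h)"] Gam_letter [of "(True, h)"] by simp_all

lemma Gam_uminus:
  assumes "g \<in> Gam"
  shows "- g \<in> Gam"
proof -
  have "- eval_word ws \<in> Gam" for ws
  proof (induction ws)
    case (Cons l ws)
    obtain b h where l: "l = (b, h)" by (cases l)
    have "- eval_word (l # ws) = - eval_word ws + letter (b, - h)"
      unfolding l by (simp only: list.map sum_list.Cons minus_add letter_uminus)
    then show ?case
      using Gam_add [OF Cons.IH Gam_letter] by metis
  qed simp
  then show ?thesis using assms by (auto simp: Gam_def)
qed

lemma Gam_diff: "g \<in> Gam \<Longrightarrow> h \<in> Gam \<Longrightarrow> g - h \<in> Gam"
  using Gam_add [of g "- h"] Gam_uminus [of h] by simp

lemma countable_Gam: "countable Gam"
  unfolding Gam_def by (intro countable_image) simp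

primrec multiple :: "'a::monoid_add \<Rightarrow> nat \<Rightarrow> 'a" where
  "multiple g 0 = 0"
| "multiple g (Suc n) = multiple g n + g"

subsection \<open>Torsion and the center\<close>

text \<open>The symplectic term \<open>x * y' - x' * y\<close> vanishes on multiples of one element,
  so only \<open>u * v'\<close> disturbs the last coordinate. Once \<open>u\<close> and
  \<open>v\<close> are zero, that coordinate is linear too.\<close>

lemma multiple_Heis:
  "\<exists>z'. multiple (Heis x y u v z) n = Heis (int n * x) (int n * y) (int n * u) (int n * v) z' \<and>
        (u = 0 \<and> v = 0 \<longrightarrow> z' = int n * z)"
proof (induction n)
  case 0
  then show ?case by (auto simp: zero_heis_def)
next
  case (Suc n)
  then obtain z' where z': "multiple (Heis x y u v z) n =
      Heis (int n * x) (int n * y) (int n * u) (int n * v) z'" "u = 0 \<and> v = 0 \<longrightarrow> z' = int n * z"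
    by blast
  show ?case by (simp add: z'(1)) (use z'(2) in \<open>auto simp: algebra_simps\<close>)
qed

lemma heis_torsion_free:
  assumes "multiple h n = 0" "n > 0"
  shows "h = (0 :: heis)"
proof (cases h)
  case (Heis x y u v z)
  show ?thesis
    using assms multiple_Heis [of x y u v z n] by (auto simp: Heis zero_heis_def)
qed

lemma lab_multiple: "lab (multiple g n) = multiple (lab g) n"
  by (induction n) auto

lemma sub_multiple: "lab g = 0 \<Longrightarrow> sub (multiple g n) c = multiple (sub g c) n"
  by (induction n) auto

lemma portrait_torsion_free:
  assumes "multiple g n = 0" "n > 0"
  shows "g = (0 :: portrait)"
proof -
  have lab0: "lab g = 0" if "multiple g n = 0" for g
    using that heis_torsion_free [OF _ assms(2), of "lab g"] lab_multiple [of g n] by auto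
  show ?thesis
    using assms(1)
  proof (coinduction arbitrary: g rule: portrait_coinduct_sub)
    case (lab g)
    then show ?case using lab0 by auto
  next
    case (sub c g)
    then have "multiple (sub g c) n = 0"
      using sub_multiple [OF lab0, of g n c] by auto
    then show ?case by simp
  qed
qed

section \<open>Level-constant decorations and the centralizer of the generators\<close>

primcorec level_const :: "(nat \<Rightarrow> int) \<Rightarrow> portrait" where
  "lab (level_const f) = Heis 0 0 0 0 (f 0)"
| "sub (level_const f) = (\<lambda>c. level_const (\<lambda>n. f (Suc n)))"

lemma level_const_add: "level_const (\<lambda>n. f n + g n) = level_const f + level_const g"
  by (coinduction arbitrary: f g rule: portrait_coinduct_sub) auto

lemma level_const_zero [simp]: "level_const (\<lambda>n. 0) = 0"
  by (coinduction rule: portrait_coinduct_sub) (auto simp: zero_heis_def)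

lemma level_const_central: "level_const f + g = g + level_const f"
proof -
  have "parity (Heis 0 0 0 0 t) = False" "Heis 0 0 0 0 t + h = h + Heis 0 0 0 0 t" for t h
    by (cases h; simp)+
  then show ?thesis
    by (coinduction arbitrary: f g rule: portrait_coinduct_sub) auto
qed

fun zcoord :: "heis \<Rightarrow> int" where
  "zcoord (Heis x y u v z) = z"

text \<open>Reads the central coordinates along the all-\<open>False\<close> ray; this recovers
  \<open>f\<close> from \<open>level_const f\<close>.\<close>

primrec spine :: "nat \<Rightarrow> portrait \<Rightarrow> int" where
  "spine 0 = (\<lambda>g. zcoord (lab g))"
| "spine (Suc n) = (\<lambda>g. spine n (sub g False))"

lemma spine_level_const [simp]: "spine n (level_const f) = f n"
  by (induction n arbitrary: f) auto

definition centralizes :: "portrait \<Rightarrow> bool" where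
  "centralizes z \<longleftrightarrow> (\<forall>h. z + rooted h = rooted h + z \<and> z + directed h = directed h + z)"

lemma heis_center:
  assumes "\<And>h. k + h = h + k"
  shows "k = Heis 0 0 0 0 (zcoord k)"
proof (cases k)
  case (Heis x y u v z)
  show ?thesis
    using assms [of "Heis 1 0 0 0 0"] assms [of "Heis 0 1 0 0 0"]
      assms [of "Heis 0 0 1 0 0"] assms [of "Heis 0 0 0 1 0"]
    by (simp add: Heis)
qed

text \<open>Rooted elements force the root label into the center of \<open>heis\<close>, and an odd
  one exchanges the components, which must then agree. Directed elements, read in the two
  components, show that the common component again commutes with rooted and directed elements, so
  the step can be iterated coinductively.\<close>

lemma centralizes_step:
  assumes "centralizes z"
  shows "lab z = Heis 0 0 0 0 (zcoord (lab z))" "sub z c = sub z False" "centralizes (sub z c)"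
proof -
  have r: "z + rooted h = rooted h + z" and d: "z + directed h = directed h + z" for h
    using assms by (auto simp: centralizes_def)
  show lab: "lab z = Heis 0 0 0 0 (zcoord (lab z))"
  proof (rule heis_center)
    show "lab z + h = h + lab z" for h
      using arg_cong [OF r [of h], of lab] by simp
  qed
  have even: "\<not> parity (lab z)" by (subst lab) simp
  have eq: "sub z True = sub z False"
    using arg_cong [OF r [of "Heis 1 0 0 0 0"], of "\<lambda>g. sub g False"] by simp
  then show sub: "sub z c = sub z False"
    by (cases c) auto
  have "sub z False + rooted h = rooted h + sub z False" for h
    using arg_cong [OF d [of h], of "\<lambda>g. sub g False"] even by simp
  moreover have "sub z False + directed h = directed h + sub z False" for h
    \<comment> \<open>As \<open>rot\<close> has order three, \<open>directed (rot (rot h))\<close>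
      has \<open>directed h\<close> as its \<open>True\<close> component.\<close>
    using arg_cong [OF d [of "rot (rot h)"], of "\<lambda>g. sub g True"] even eq by simp
  ultimately show "centralizes (sub z c)"
    by (simp add: centralizes_def sub)
qed

lemma centralizes_eq_level_const:
  assumes "centralizes z"
  shows "z = level_const (\<lambda>n. spine n z)"
  using assms
proof (coinduction arbitrary: z rule: portrait_coinduct_sub)
  case (lab z)
  then show ?case using centralizes_step(1) by auto
next
  case (sub c z)
  then show ?case using centralizes_step(2,3) [of z c] by auto
qed

section \<open>Number of nontrivial labels on a level\<close>

primrec support_count :: "nat \<Rightarrow> portrait \<Rightarrow> nat" where
  "support_count 0 = (\<lambda>g. if lab g = 0 then 0 else 1)"
| "support_count (Suc n) = (\<lambda>g. support_count n (sub g False) + support_count n (sub g True))"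

text \<open>On each level, the labels of \<open>g + h\<close> are those of \<open>g\<close>,
  permuted, added to those of \<open>h\<close>.\<close>

lemma support_count_add: "support_count n (g + h) \<le> support_count n g + support_count n h"
proof (induction n arbitrary: g h)
  case (Suc n)
  show ?case
    using Suc [of "sub g False" "sub h False"] Suc [of "sub g True" "sub h True"]
      Suc [of "sub g False" "sub h True"] Suc [of "sub g True" "sub h False"]
    by (cases "parity (lab h)") auto
qed auto

lemma support_count_zero [simp]: "support_count n 0 = 0"
  by (induction n) auto

lemma support_count_rooted: "support_count n (rooted h) \<le> 1"
  by (cases n) auto

lemma support_count_directed: "support_count n (directed h) \<le> 1"
proof (induction n arbitrary: h)
  case (Suc n)
  show ?case
  proof (cases n)
    case 0
    then show ?thesis using support_count_rooted [of 0 h] by simp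
  next
    case (Suc m)
    then show ?thesis using Suc.IH [of "rot h"] by simp
  qed
qed auto

lemma support_count_Gam:
  assumes "g \<in> Gam"
  shows "\<exists>B. \<forall>n. support_count n g \<le> B"
proof -
  have "support_count n (eval_word ws) \<le> length ws" for n ws
  proof (induction ws)
    case (Cons l ws)
    have "support_count n (letter l) \<le> 1"
      by (cases l) (simp add: support_count_rooted [simplified] support_count_directed [simplified])
    then show ?case
      using Cons support_count_add [of n "letter l" "eval_word ws"] by simp
  qed simp
  then show ?thesis using assms by (auto simp: Gam_def)
qed

lemma support_count_level_const: "support_count n (level_const f) = (if f n = 0 then 0 else 2 ^ n)"
  by (induction n arbitrary: f) (auto simp: zero_heis_def)

text \<open>A nonzero value on level \<open>n\<close> means \<open>2 ^ n\<close> nontrivial labels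
  there, against a bound uniform in \<open>n\<close>.\<close>

lemma level_const_Gam_finite_support:
  assumes "level_const f \<in> Gam"
  shows "finite {n. f n \<noteq> 0}"
proof -
  obtain B where B: "\<And>n. support_count n (level_const f) \<le> B" using support_count_Gam [OF assms] by blast
  have "n \<le> B" if "f n \<noteq> 0" for n
  proof -
    have "n < 2 ^ n" by (rule less_exp)
    also have "2 ^ n \<le> B" using B [of n] that by (simp add: support_count_level_const)
    finally show ?thesis by simp
  qed
  then show ?thesis by (auto intro: finite_subset [of _ "{..B}"])
qed

section \<open>A branching subgroup and the central elements it contains\<close>

text \<open>A normal subgroup that contains its own copy supported on one subtree.\<close>

inductive_set branch :: "portrait set" where
  comm: "directed (Heis 0 0 u v z) + rooted y - directed (Heis 0 0 u v z) - rooted y \<in> branch"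
| dir: "directed (Heis 0 0 0 0 t) \<in> branch"
| add: "g \<in> branch \<Longrightarrow> h \<in> branch \<Longrightarrow> g + h \<in> branch"
| minus: "g \<in> branch \<Longrightarrow> - g \<in> branch"
| conj_rooted: "g \<in> branch \<Longrightarrow> rooted y + g - rooted y \<in> branch"
| conj_directed: "g \<in> branch \<Longrightarrow> directed y + g - directed y \<in> branch"

lemma branch_subset_Gam: "g \<in> branch \<Longrightarrow> g \<in> Gam"
  by (induction rule: branch.induct) (auto intro!: Gam_add Gam_diff Gam_uminus Gam_rooted Gam_directed)

abbreviation odd_elt :: heis where "odd_elt \<equiv> Heis 1 0 0 0 0"

lemma twisted_True: "twisted True x = rooted odd_elt + directed x - rooted odd_elt"
  using twisted_conj [of False odd_elt x] by (simp add: twisted_False)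

text \<open>Brings both sides of a group identity to right-associated reduced words.\<close>

lemmas group_normalize =
  diff_conv_add_uminus minus_add minus_minus add.assoc add_minus_cancel minus_add_cancel

lemma branch_conj_twisted:
  assumes "g \<in> branch"
  shows "twisted e x + g - twisted e x \<in> branch"
proof (cases e)
  case True
  have "twisted e x + g - twisted e x =
    rooted odd_elt + (directed x + (rooted (- odd_elt) + g - rooted (- odd_elt)) - directed x)
      - rooted odd_elt"
    by (simp only: True twisted_True rooted_uminus group_normalize)
  then show ?thesis using assms by (auto intro: branch.intros)
next
  case False
  then show ?thesis using branch.conj_directed [OF assms] by (simp add: twisted_False)
qed

text \<open>Writing \<open>?D\<close> as the conjugate of \<open>directed y\<close> by the odd
  rooted element \<open>?r\<close>, the commutator of \<open>?d\<close> and \<open>?D\<close> is the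
  product of the commutator \<open>c\<close> of \<open>?d\<close> and \<open>?r\<close>, a conjugate
  of the commutator of \<open>?d\<close> and \<open>directed y\<close>, and a conjugate of
  \<open>- c\<close>. The middle factor is \<open>directed\<close> of a commutator in
  \<open>heis\<close>, hence of a central element.\<close>

lemma branch_commutator_twisted:
  "directed (Heis 0 0 u v z) + twisted True y - directed (Heis 0 0 u v z) - twisted True y \<in> branch"
    (is "?d + ?D - ?d - ?D \<in> branch")
proof -
  let ?r = "rooted odd_elt"
  define c where "c = ?d + ?r - ?d - ?r"
  have c: "c \<in> branch" unfolding c_def by (rule branch.comm)
  obtain x' y' u' v' z' where y: "y = Heis x' y' u' v' z'" by (cases y)
  have "?d + directed y - ?d - directed y = directed (Heis 0 0 0 0 (u * v' - u' * v))"
    unfolding y by (simp flip: directed_add directed_uminus add: diff_conv_add_uminus del: add_uminus_conv_diff)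
       (simp add: algebra_simps)
  then have "?d + directed y - ?d - directed y \<in> branch" by (simp add: branch.dir)
  then have "c + (?r + (?d + directed y - ?d - directed y) - ?r) + (?D - c - ?D) \<in> branch"
    using c branch_conj_twisted [OF branch.minus [OF c], of True y] by (auto intro!: branch.intros)
  moreover have "c + (?r + (?d + directed y - ?d - directed y) - ?r) + (?D - c - ?D)
      = ?d + ?D - ?d - ?D"
    unfolding c_def twisted_True by (simp only: group_normalize)
  ultimately show ?thesis by metis
qed

lemma rooted_even_commute:
  assumes "\<not> parity h"
  shows "rooted h + twisted e x = twisted e x + rooted h"
  using rooted_twisted [of h e x] assms by simp

text \<open>Take the commutator of \<open>directed ?h\<close> and \<open>twisted True y\<close>. In
  the \<open>False\<close> component \<open>rooted ?h\<close> meets a directed element and commutes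
  with it, as \<open>?h\<close> is even; in the \<open>True\<close> component the original
  commutator reappears, as \<open>rot\<close> fixes \<open>?h\<close>.\<close>

lemma pair_commutator_branch:
  "pair 0 (directed (Heis 0 0 u v z) + rooted y - directed (Heis 0 0 u v z) - rooted y) \<in> branch"
proof -
  let ?h = "Heis 0 0 u v z"
  have "rooted ?h + directed (rot y) = directed (rot y) + rooted ?h"
    using rooted_even_commute [of ?h False "rot y"] by (simp add: twisted_False)
  then have "pair 0 (directed ?h + rooted y - directed ?h - rooted y) =
      directed ?h + twisted True y - directed ?h - twisted True y"
    by (intro portrait_eqI [of "pair _ _"]) (auto simp: diff_eq_eq)
  then show ?thesis
    using branch_commutator_twisted by metis
qed

lemma commutator_diff:
  fixes a b h :: "'a::group_add"
  assumes "b + h = h + b"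
  shows "(a - b) + h - (a - b) - h = a + h - a - h"
proof -
  have "(a - b) + h - (a - b) - h = a + (- b + (h + b)) - a - h"
    by (simp only: group_normalize)
  also have "\<dots> = a + h - a - h"
    by (simp flip: assms)
  finally show ?thesis .
qed

text \<open>The central element \<open>Heis 0 0 0 0 t\<close> is the commutator of \<open>?x\<close>
  and \<open>?h\<close>. The factor \<open>twisted True ?x\<close> of \<open>u\<close> commutes with
  \<open>directed ?h\<close>, as one sees in the components, so the commutator of \<open>u\<close>
  and \<open>directed ?h\<close> is \<open>directed (Heis 0 0 0 0 t)\<close>. As \<open>rot\<close>
  fixes \<open>?h\<close>, the commutator of \<open>pair 0 u\<close> and \<open>directed ?h\<close>
  places it on one subtree.\<close>

lemma pair_directed_branch: "pair 0 (directed (Heis 0 0 0 0 t)) \<in> branch"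
proof -
  let ?x = "Heis 0 0 t 0 0" and ?h = "Heis 0 0 0 1 0"
  define u where "u = directed ?x + rooted odd_elt - directed ?x - rooted odd_elt"
  have u: "pair 0 u \<in> branch"
    unfolding u_def by (rule pair_commutator_branch)
  have u': "u = directed ?x - twisted True ?x"
    unfolding u_def twisted_True by (simp only: group_normalize)
  have xh: "?x + ?h - ?x - ?h = Heis 0 0 0 0 t"
    by (simp add: diff_conv_add_uminus del: add_uminus_conv_diff)
  have comm: "rooted a + directed b = directed b + rooted a" if "\<not> parity a" for a b
    using rooted_even_commute [OF that, of False b] by (simp add: twisted_False)
  have "u + directed ?h - u - directed ?h = directed (Heis 0 0 0 0 t)"
  proof (rule portrait_eqI)
    show "sub (u + directed ?h - u - directed ?h) c = sub (directed (Heis 0 0 0 0 t)) c" for c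
    proof (cases c)
      case True
      have "(directed ?x - rooted ?x) + directed ?h - (directed ?x - rooted ?x) - directed ?h
          = directed ?x + directed ?h - directed ?x - directed ?h"
        using comm [of ?x ?h] by (intro commutator_diff) simp
      also have "\<dots> = directed (Heis 0 0 0 0 t)"
        unfolding xh [symmetric] by (simp only: directed_add directed_uminus diff_conv_add_uminus)
      finally show ?thesis by (simp add: u' True)
    next
      case False
      have "(rooted ?x - directed ?x) + rooted ?h - (rooted ?x - directed ?x) - rooted ?h
          = rooted ?x + rooted ?h - rooted ?x - rooted ?h"
        using comm [of ?h ?x] by (intro commutator_diff) simp
      also have "\<dots> = rooted (Heis 0 0 0 0 t)"
        unfolding xh [symmetric] by (simp only: rooted_add rooted_uminus diff_conv_add_uminus)
      finally show ?thesis by (simp add: u' False)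
    qed
  qed (simp add: u')
  moreover have "pair 0 (u + directed ?h - u - directed ?h)
      = pair 0 u + (directed ?h + - pair 0 u - directed ?h)"
    by (rule portrait_eqI) (auto simp: add_diff_eq)
  moreover have "pair 0 u + (directed ?h + - pair 0 u - directed ?h) \<in> branch"
    using u by (intro branch.intros)
  ultimately show ?thesis by metis
qed

text \<open>The conjugation rules lift because \<open>twisted True y\<close> and
  \<open>directed (rot (rot y))\<close> have \<open>rooted y\<close> and \<open>directed y\<close>
  as their \<open>True\<close> components.\<close>

lemma pair_branch:
  assumes "g \<in> branch"
  shows "pair 0 g \<in> branch"
  using assms
proof (induction rule: branch.induct)
  case (comm u v z y)
  then show ?case by (rule pair_commutator_branch)
next
  case (dir t)
  then show ?case by (rule pair_directed_branch)
next
  case (add g h)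
  then show ?case using branch.add [of "pair 0 g" "pair 0 h"] by (simp add: pair_add)
next
  case (minus g)
  then show ?case using branch.minus [of "pair 0 g"] by (simp add: pair_uminus)
next
  case (conj_rooted g y)
  have "pair 0 (rooted y + g - rooted y) = twisted True y + pair 0 g - twisted True y"
    by (rule portrait_eqI) auto
  then show ?case using branch_conj_twisted [OF conj_rooted.IH, of True y] by simp
next
  case (conj_directed g y)
  have "pair 0 (directed y + g - directed y)
      = directed (rot (rot y)) + pair 0 g - directed (rot (rot y))"
    by (rule portrait_eqI) auto
  then show ?case using branch.conj_directed [OF conj_directed.IH, of "rot (rot y)"] by simp
qed

text \<open>Conjugation by an odd rooted element moves the copy of \<open>g\<close> to the other
  subtree.\<close>

lemma pair_diag_branch:
  assumes "pair 0 g \<in> branch"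
  shows "pair g g \<in> branch"
proof -
  have "pair g g = pair 0 g + (rooted odd_elt + pair 0 g - rooted odd_elt)"
    by (rule portrait_eqI) auto
  then show ?thesis using assms by (auto intro: branch.intros)
qed

lemma level_const_single_branch: "level_const (\<lambda>k. if k = Suc n then t else 0) \<in> branch"
proof (induction n)
  case 0
  \<comment> \<open>As \<open>rot\<close> fixes central elements, \<open>directed\<close> of such an
    element has \<open>rooted\<close> and \<open>directed\<close> of the same element as components;
    subtracting the latter leaves a single nontrivial label.\<close>
  have "pair (rooted (Heis 0 0 0 0 t)) 0
      = directed (Heis 0 0 0 0 t) - pair 0 (directed (Heis 0 0 0 0 t))"
    by (rule portrait_eqI) auto
  also have "\<dots> \<in> branch"
    using branch.add [OF branch.dir [of t] branch.minus [OF pair_directed_branch [of t]]] by simp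
  finally have "rooted odd_elt + pair (rooted (Heis 0 0 0 0 t)) 0 - rooted odd_elt \<in> branch"
    by (rule branch.conj_rooted)
  moreover have "rooted odd_elt + pair (rooted (Heis 0 0 0 0 t)) 0 - rooted odd_elt
      = pair 0 (rooted (Heis 0 0 0 0 t))"
    by (rule portrait_eqI) auto
  ultimately have "pair (rooted (Heis 0 0 0 0 t)) (rooted (Heis 0 0 0 0 t)) \<in> branch"
    using pair_diag_branch by metis
  moreover have "level_const (\<lambda>k. if k = Suc 0 then t else 0)
      = pair (rooted (Heis 0 0 0 0 t)) (rooted (Heis 0 0 0 0 t))"
    by (rule portrait_eqI; (simp add: zero_heis_def)?) (rule portrait_eqI; simp)
  ultimately show ?case by simp
next
  case (Suc n)
  have "level_const (\<lambda>k. if k = Suc (Suc n) then t else 0)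
      = pair (level_const (\<lambda>k. if k = Suc n then t else 0)) (level_const (\<lambda>k. if k = Suc n then t else 0))"
    by (rule portrait_eqI) (auto simp: zero_heis_def)
  then show ?case using pair_diag_branch [OF pair_branch [OF Suc]] by simp
qed

lemma level_const_single_Gam: "level_const (\<lambda>k. if k = n then t else 0) \<in> Gam"
proof (cases n)
  case 0
  have "level_const (\<lambda>k. if k = 0 then t else 0) = rooted (Heis 0 0 0 0 t)"
    by (rule portrait_eqI) auto
  then show ?thesis using Gam_rooted 0 by simp
next
  case (Suc m)
  then show ?thesis using branch_subset_Gam [OF level_const_single_branch] by simp
qed

lemma level_const_Gam:
  assumes "finite {n. f n \<noteq> 0}"
  shows "level_const f \<in> Gam"
proof -
  have "level_const (\<lambda>k. if k \<in> A then f k else 0) \<in> Gam" if "finite A" for A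
    using that
  proof (induction A)
    case (insert n A)
    have "(\<lambda>k. if k \<in> insert n A then f k else 0) =
        (\<lambda>k. (if k = n then f n else 0) + (if k \<in> A then f k else 0))"
      using insert by auto
    then have "level_const (\<lambda>k. if k \<in> insert n A then f k else 0) =
        level_const (\<lambda>k. if k = n then f n else 0) + level_const (\<lambda>k. if k \<in> A then f k else 0)"
      by (simp only: level_const_add)
    then show ?case using Gam_add [OF level_const_single_Gam insert.IH] by metis
  qed simp
  moreover have "f = (\<lambda>k. if k \<in> {n. f n \<noteq> 0} then f k else 0)" by auto
  ultimately show ?thesis using assms by metis
qed

lemma center_Gam:
  "{z \<in> Gam. \<forall>g \<in> Gam. z + g = g + z} = level_const ` {f. finite {n. f n \<noteq> 0}}"
proof (intro equalityI subsetI)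
  fix z
  assume z: "z \<in> {z \<in> Gam. \<forall>g \<in> Gam. z + g = g + z}"
  then have "centralizes z"
    unfolding centralizes_def using Gam_rooted Gam_directed by auto
  then obtain f where "z = level_const f" using centralizes_eq_level_const by blast
  then show "z \<in> level_const ` {f. finite {n. f n \<noteq> 0}}"
    using z level_const_Gam_finite_support [of f] by auto
qed (auto simp: level_const_Gam level_const_central)

subsection \<open>Contraction and subexponential growth\<close>

text \<open>The weights make \<open>weight_contract\<close> hold: with \<open>3\<close> for the syllable itself, the classes along the
  \<open>rot\<close>-cycle weigh 9, 8, 7, and only the last of them has even parity.\<close>

fun weight :: "heis \<Rightarrow> nat" where
  "weight (Heis x y u v z) = (if odd x then if odd y then 4 else 6 else if odd y then 5 else 0)"

text \<open>Merging syllables must not raise the cost: the nontrivial weights \<open>4\<close>,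
  \<open>5\<close>, \<open>6\<close> satisfy the triangle inequalities.\<close>

lemma weight_add: "weight (a + b) \<le> weight a + weight b"
  by (cases a; cases b) auto

lemma weight_zero [simp]: "weight 0 = 0"
  by (simp add: zero_heis_def)

lemma weight_le: "weight h \<le> 6"
  by (cases h) auto

lemma weight_contract: "9 * (weight (rot h) + (if parity h then 3 else 0)) \<le> 8 * (3 + weight h)"
  by (cases h) auto

text \<open>The bound on \<open>x - y\<close> makes the box invariant under \<open>rot\<close>.\<close>

fun in_box :: "nat \<Rightarrow> heis \<Rightarrow> bool" where
  "in_box n (Heis x y u v z) \<longleftrightarrow>
     \<bar>x\<bar> \<le> int n \<and> \<bar>y\<bar> \<le> int n \<and> \<bar>x - y\<bar> \<le> int n \<and> \<bar>u\<bar> \<le> int n \<and> \<bar>v\<bar> \<le> int n \<and>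
     \<bar>z\<bar> \<le> 2 * (int n)\<^sup>2"

section \<open>A subadditive norm with balls of polynomial size\<close>

definition nrm :: "heis \<Rightarrow> nat" where
  "nrm h = (LEAST n. in_box n h)"

lemma in_box_mono:
  assumes "in_box m h" "m \<le> n"
  shows "in_box n h"
proof -
  have "(int m)\<^sup>2 \<le> (int n)\<^sup>2"
    using assms(2) by (intro power_mono) auto
  then show ?thesis
    using assms by (cases h) (auto intro: order_trans)
qed

lemma in_box_ex: "\<exists>n. in_box n h"
proof (cases h)
  case (Heis x y u v z)
  define n where "n = nat (\<bar>x\<bar> + \<bar>y\<bar> + \<bar>u\<bar> + \<bar>v\<bar> + \<bar>z\<bar>)"
  have n: "int n = \<bar>x\<bar> + \<bar>y\<bar> + \<bar>u\<bar> + \<bar>v\<bar> + \<bar>z\<bar>"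
    by (simp add: n_def)
  have "int n \<le> (int n)\<^sup>2"
    by (cases "n = 0") (auto simp: power2_eq_square)
  moreover have "0 \<le> (int n)\<^sup>2" by simp
  ultimately have "\<bar>z\<bar> \<le> 2 * (int n)\<^sup>2" using n by linarith
  then have "in_box n h"
    unfolding Heis in_box.simps using n by (intro conjI; linarith)
  then show ?thesis ..
qed

lemma nrm_le_iff: "nrm h \<le> n \<longleftrightarrow> in_box n h"
proof
  assume "nrm h \<le> n"
  moreover have "in_box (nrm h) h"
    unfolding nrm_def by (rule LeastI_ex [OF in_box_ex])
  ultimately show "in_box n h"
    using in_box_mono by blast
qed (simp add: nrm_def Least_le)

lemma in_box_nrm: "in_box (nrm h) h"
  using nrm_le_iff by blast

lemma nrm_zero [simp]: "nrm 0 = 0"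
  using nrm_le_iff [of 0 0] by (simp add: zero_heis_def)

lemma in_box_rot: "in_box n (rot h) \<longleftrightarrow> in_box n h"
  by (cases h) auto

lemma nrm_rot [simp]: "nrm (rot h) = nrm h"
  by (simp add: nrm_def in_box_rot)

text \<open>Expanding \<open>2 * (m + n)\<^sup>2\<close> leaves \<open>4 * m * n\<close>, which
  absorbs the three products in the last coordinate.\<close>

lemma in_box_add:
  assumes "in_box m a" "in_box n b"
  shows "in_box (m + n) (a + b)"
proof -
  obtain x y u v z where a: "a = Heis x y u v z" by (cases a)
  obtain x' y' u' v' z' where b: "b = Heis x' y' u' v' z'" by (cases b)
  have tri: "\<bar>p + q\<bar> \<le> int m + int n" if "\<bar>p\<bar> \<le> int m" "\<bar>q\<bar> \<le> int n" for p q
    using that by linarith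
  have prod: "\<bar>p * q\<bar> \<le> int m * int n" if "\<bar>p\<bar> \<le> int m" "\<bar>q\<bar> \<le> int n" for p q
    unfolding abs_mult using that by (intro mult_mono) auto
  have "\<bar>x * y'\<bar> \<le> int m * int n" "\<bar>y * x'\<bar> \<le> int m * int n" "\<bar>u * v'\<bar> \<le> int m * int n"
    using assms by (auto simp: a b intro!: prod)
  moreover have "\<bar>z\<bar> \<le> 2 * (int m)\<^sup>2" "\<bar>z'\<bar> \<le> 2 * (int n)\<^sup>2"
    using assms by (auto simp: a b)
  moreover have "2 * (int (m + n))\<^sup>2 = 2 * (int m)\<^sup>2 + 2 * (int n)\<^sup>2 + 4 * (int m * int n)"
    by (simp add: power2_eq_square algebra_simps)
  moreover have "0 \<le> int m * int n" by simp
  ultimately have "\<bar>z + z' + (x * y' - x' * y) + u * v'\<bar> \<le> 2 * (int (m + n))\<^sup>2"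
    by (simp only: mult.commute [of x' y])
  then show ?thesis
    using assms tri [of x x'] tri [of y y'] tri [of "x - y" "x' - y'"] tri [of u u'] tri [of v v']
    by (simp add: a b add_diff_add)
qed

lemma nrm_add: "nrm (a + b) \<le> nrm a + nrm b"
  unfolding nrm_le_iff by (intro in_box_add in_box_nrm)

definition box :: "nat \<Rightarrow> heis set" where
  "box n = {h. nrm h \<le> n}"

lemma box_zero [simp]: "0 \<in> box n"
  by (simp add: box_def)

lemma box_subset:
  "box n \<subseteq> (\<lambda>(x, y, u, v, z). Heis x y u v z) `
     ({- int n..int n} \<times> {- int n..int n} \<times> {- int n..int n} \<times> {- int n..int n} \<times>
      {- 2 * (int n)\<^sup>2..2 * (int n)\<^sup>2})"
proof
  fix h
  assume "h \<in> box n"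
  then have "in_box n h" by (simp add: box_def nrm_le_iff)
  then show "h \<in> (\<lambda>(x, y, u, v, z). Heis x y u v z) `
     ({- int n..int n} \<times> {- int n..int n} \<times> {- int n..int n} \<times> {- int n..int n} \<times>
      {- 2 * (int n)\<^sup>2..2 * (int n)\<^sup>2})"
    by (cases h) (auto simp: image_iff abs_le_iff)
qed

lemma finite_box [simp]: "finite (box n)"
  by (rule finite_subset [OF box_subset]) auto

text \<open>Four coordinates have linear range and one has quadratic range, which gives degree
  six.\<close>

lemma card_box: "real (card (box n)) \<le> 64 * (real n + 1) ^ 6"
proof -
  have "card (box n) \<le> card ({- int n..int n} \<times> {- int n..int n} \<times> {- int n..int n} \<times>
      {- int n..int n} \<times> {- 2 * (int n)\<^sup>2..2 * (int n)\<^sup>2})"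
    by (rule surj_card_le [OF _ box_subset]) auto
  also have "\<dots> = nat (2 * int n + 1) ^ 4 * nat (4 * (int n)\<^sup>2 + 1)"
    by (simp add: card_cartesian_product power4_eq_xxxx algebra_simps)
  also have "\<dots> = (2 * n + 1) ^ 4 * (4 * n\<^sup>2 + 1)"
  proof -
    have "nat (2 * int n + 1) = 2 * n + 1" by simp
    moreover have "4 * (int n)\<^sup>2 + 1 = int (4 * n\<^sup>2 + 1)" by simp
    ultimately show ?thesis by (metis nat_int)
  qed
  finally have "real (card (box n)) \<le> real ((2 * n + 1) ^ 4 * (4 * n\<^sup>2 + 1))"
    by (rule of_nat_mono)
  also have "\<dots> = (2 * real n + 1) ^ 4 * (4 * (real n)\<^sup>2 + 1)"
    by (simp add: algebra_simps)
  also have "\<dots> \<le> (2 * (real n + 1)) ^ 4 * (4 * (real n + 1)\<^sup>2)"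
    by (intro mult_mono power_mono) (auto simp: power2_eq_square algebra_simps)
  also have "\<dots> = 64 * (real n + 1) ^ 6"
  proof -
    have "(2 * a) ^ 4 * (4 * a\<^sup>2) = 64 * a ^ 6" for a :: real
      by (simp add: power_mult_distrib flip: power_add)
    then show ?thesis .
  qed
  finally show ?thesis .
qed

section \<open>Alternating words and their components\<close>

fun alt :: "bool \<Rightarrow> heis list \<Rightarrow> portrait" where
  "alt e [] = 0"
| "alt e (x # xs) = twisted e x + alt (\<not> e) xs"

lemma lab_alt [simp]: "lab (alt e xs) = 0"
  by (induction e xs rule: alt.induct) auto

lemma rooted_alt: "rooted h + alt e xs = alt (e \<noteq> parity h) xs + rooted h"
proof (induction e xs rule: alt.induct)
  case (2 e x xs)
  have "rooted h + alt e (x # xs) = twisted (e \<noteq> parity h) x + (rooted h + alt (\<not> e) xs)"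
    by (simp add: add.assoc [symmetric] rooted_twisted)
  also have "\<dots> = twisted (e \<noteq> parity h) x + alt ((\<not> e) \<noteq> parity h) xs + rooted h"
    by (simp only: 2 add.assoc)
  finally show ?case by simp
qed simp

definition cost :: "heis list \<Rightarrow> nat" where
  "cost ys = (\<Sum>y\<leftarrow>ys. 3 + weight y)"

definition tnrm :: "heis list \<Rightarrow> nat" where
  "tnrm ys = (\<Sum>y\<leftarrow>ys. nrm y)"

lemma cost_simps [simp]: "cost [] = 0" "cost (y # ys) = 3 + weight y + cost ys"
  and tnrm_simps [simp]: "tnrm [] = 0" "tnrm (y # ys) = nrm y + tnrm ys"
  by (simp_all add: cost_def tnrm_def)

text \<open>An odd rooted letter costs \<open>3\<close> because it prepays the syllable that may be
  opened after it; even rooted letters are free.\<close>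

primrec letter_cost :: "bool \<times> heis \<Rightarrow> nat" where
  "letter_cost (b, h) = (if b then weight h else if parity h then 3 else 0)"

primrec directed_nrm :: "bool \<times> heis \<Rightarrow> nat" where
  "directed_nrm (b, h) = (if b then nrm h else 0)"

primrec rooted_nrm :: "bool \<times> heis \<Rightarrow> nat" where
  "rooted_nrm (b, h) = (if b then 0 else nrm h)"

text \<open>Even rooted letters commute with directed ones, so directed letters separated by an even rooted
  element merge into one syllable. The empty word is represented by the syllable list \<open>[0]\<close>.\<close>

lemma word_normal_form:
  "\<exists>e ys k. ys \<noteq> [] \<and> eval_word ws = alt e ys + rooted k \<and>
     cost ys + (if e then 3 else 0) \<le> 3 + sum_list (map letter_cost ws) \<and>
     tnrm ys \<le> sum_list (map directed_nrm ws) \<and>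
     nrm k \<le> sum_list (map rooted_nrm ws)"
proof (induction ws)
  case Nil
  have "[0] \<noteq> ([] :: heis list) \<and> eval_word [] = alt False [0] + rooted 0"
    by (simp add: twisted_False)
  moreover have "cost [0] = 3" "tnrm [0] = 0" by simp_all
  ultimately show ?case by (intro exI [of _ False] exI [of _ "[0]"] exI [of _ 0]) simp
next
  case (Cons l ws)
  then obtain e ys k where IH: "ys \<noteq> []" "eval_word ws = alt e ys + rooted k"
     "cost ys + (if e then 3 else 0) \<le> 3 + sum_list (map letter_cost ws)"
     "tnrm ys \<le> sum_list (map directed_nrm ws)"
     "nrm k \<le> sum_list (map rooted_nrm ws)" by blast
  obtain b h where l: "l = (b, h)" by (cases l)
  show ?case
  proof (cases b)
    case False
    have "eval_word (l # ws) = alt (e \<noteq> parity h) ys + rooted (h + k)"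
      by (simp add: l False IH(2) rooted_add add.assoc [symmetric] rooted_alt)
    then show ?thesis
      using IH nrm_add [of h k]
      by (intro exI [of _ "e \<noteq> parity h"] exI [of _ ys] exI [of _ "h + k"]) (auto simp: l False)
  next
    case True
    show ?thesis
    proof (cases e)
      case e: True
      \<comment> \<open>The new syllable costs \<open>3 + weight h\<close>. Its \<open>3\<close> is
        the surplus \<open>if e then 3 else 0\<close>, which is released when \<open>e\<close>
        becomes \<open>False\<close>.\<close>
      have "eval_word (l # ws) = alt False (h # ys) + rooted k"
        by (simp add: l True e IH(2) twisted_False add.assoc)
      then show ?thesis
        using IH e
        by (intro exI [of _ False] exI [of _ "h # ys"] exI [of _ k]) (auto simp: l True)
    next
      case e: False
      obtain y zs where ys: "ys = y # zs" using IH(1) by (cases ys) auto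
      have "eval_word (l # ws) = alt False ((h + y) # zs) + rooted k"
        by (simp add: l True e ys IH(2) twisted_add twisted_False directed_add add.assoc)
      then show ?thesis
        using IH e nrm_add [of h y] weight_add [of h y]
        by (intro exI [of _ False] exI [of _ "(h + y) # zs"] exI [of _ k]) (auto simp: l True ys)
    qed
  qed
qed

fun child :: "bool \<Rightarrow> bool \<Rightarrow> heis list \<Rightarrow> (bool \<times> heis) list" where
  "child c e [] = []"
| "child c e (x # xs) = (if c = e then (False, x) else (True, rot x)) # child c (\<not> e) xs"

lemma sub_alt: "sub (alt e xs) c = eval_word (child c e xs)"
  by (induction e xs rule: alt.induct) auto

text \<open>A syllable sends a rooted letter to one component and a directed letter to the other;
  charging both together, this is \<open>weight_contract\<close> summed over the syllables.\<close>

lemma child_cost: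
  "9 * (sum_list (map letter_cost (child False e xs)) + sum_list (map letter_cost (child True e xs)))
     \<le> 8 * cost xs"
proof (induction e xs rule: alt.induct)
  case (2 e x xs)
  then show ?case using weight_contract [of x] by (cases e) auto
qed simp

lemma child_directed_nrm:
  "sum_list (map directed_nrm (child False e xs)) + sum_list (map directed_nrm (child True e xs))
     = tnrm xs"
  by (induction e xs rule: alt.induct) auto

text \<open>A bound for each component separately is enough, because rooted parts enter the count
  only through the polynomial size of \<open>box m\<close>.\<close>

lemma child_rooted_nrm: "sum_list (map rooted_nrm (child c e xs)) \<le> tnrm xs"
  by (induction e xs rule: alt.induct) auto

definition alt_ball :: "nat \<Rightarrow> nat \<Rightarrow> portrait set" where
  "alt_ball w m = {alt e ys | e ys. cost ys \<le> w \<and> tnrm ys \<le> m}"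

definition rooted_alt_ball :: "nat \<Rightarrow> nat \<Rightarrow> nat \<Rightarrow> portrait set" where
  "rooted_alt_ball w m n = (\<lambda>(g, k). g + rooted k) ` (alt_ball w m \<times> box n)"

lemma rooted_alt_ballI:
  "cost ys \<le> w \<Longrightarrow> tnrm ys \<le> m \<Longrightarrow> nrm k \<le> n \<Longrightarrow> alt e ys + rooted k \<in> rooted_alt_ball w m n"
  unfolding rooted_alt_ball_def alt_ball_def box_def by force

text \<open>The \<open>54\<close> is \<open>9 * (3 + 3)\<close>: the normal form of each component
  may add \<open>3\<close> to the cost of its letters.\<close>

lemma sub_alt_ball:
  assumes "g \<in> alt_ball w m"
  shows "\<exists>w0 m0 w1 m1. 9 * (w0 + w1) \<le> 54 + 8 * w \<and> m0 + m1 \<le> m \<and>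
    sub g False \<in> rooted_alt_ball w0 m0 m \<and> sub g True \<in> rooted_alt_ball w1 m1 m"
proof -
  obtain e xs where g: "g = alt e xs" and w: "cost xs \<le> w" and m: "tnrm xs \<le> m"
    using assms by (auto simp: alt_ball_def)
  obtain e0 ys k where 0: "eval_word (child False e xs) = alt e0 ys + rooted k"
     "cost ys + (if e0 then 3 else 0) \<le> 3 + sum_list (map letter_cost (child False e xs))"
     "tnrm ys \<le> sum_list (map directed_nrm (child False e xs))"
     "nrm k \<le> sum_list (map rooted_nrm (child False e xs))"
    using word_normal_form [of "child False e xs"] by blast
  obtain e1 ys' k' where 1: "eval_word (child True e xs) = alt e1 ys' + rooted k'"
     "cost ys' + (if e1 then 3 else 0) \<le> 3 + sum_list (map letter_cost (child True e xs))"
     "tnrm ys' \<le> sum_list (map directed_nrm (child True e xs))"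
     "nrm k' \<le> sum_list (map rooted_nrm (child True e xs))"
    using word_normal_form [of "child True e xs"] by blast
  have "9 * (cost ys + cost ys') \<le> 54 + 8 * w"
    using 0(2) 1(2) child_cost [of e xs] w by (auto split: if_splits)
  moreover have "tnrm ys + tnrm ys' \<le> m"
    using 0(3) 1(3) child_directed_nrm [of e xs] m by linarith
  moreover have "sub g False \<in> rooted_alt_ball (cost ys) (tnrm ys) m"
    unfolding g sub_alt 0(1)
    using 0(4) child_rooted_nrm [of False e xs] m by (intro rooted_alt_ballI) auto
  moreover have "sub g True \<in> rooted_alt_ball (cost ys') (tnrm ys') m"
    unfolding g sub_alt 1(1)
    using 1(4) child_rooted_nrm [of True e xs] m by (intro rooted_alt_ballI) auto
  ultimately show ?thesis by blast
qed

section \<open>Lists of bounded length and total norm\<close>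

definition short_lists :: "nat \<Rightarrow> nat \<Rightarrow> heis list set" where
  "short_lists n m = {ys. length ys \<le> n \<and> tnrm ys \<le> m}"

lemma short_lists_Suc:
  "short_lists (Suc n) m \<subseteq> insert [] (\<Union>x\<in>box m. (#) x ` short_lists n (m - nrm x))"
proof
  fix ys
  assume "ys \<in> short_lists (Suc n) m"
  then show "ys \<in> insert [] (\<Union>x\<in>box m. (#) x ` short_lists n (m - nrm x))"
    by (cases ys) (auto simp: short_lists_def box_def image_iff intro!: exI [of _ "hd ys"])
qed

lemma finite_short_lists [simp]: "finite (short_lists n m)"
proof (induction n arbitrary: m)
  case 0
  have "short_lists 0 m \<subseteq> {[]}" by (auto simp: short_lists_def)
  then show ?case by (rule finite_subset) simp
next
  case (Suc n)
  then show ?case by (intro finite_subset [OF short_lists_Suc]) auto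
qed

lemma length_le_cost: "length ys \<le> cost ys"
  by (induction ys) auto

lemma alt_ball_subset: "alt_ball w m \<subseteq> (\<lambda>(e, ys). alt e ys) ` (UNIV \<times> short_lists w m)"
proof
  fix g
  assume "g \<in> alt_ball w m"
  then obtain e ys where "g = alt e ys" "cost ys \<le> w" "tnrm ys \<le> m"
    by (auto simp: alt_ball_def)
  then show "g \<in> (\<lambda>(e, ys). alt e ys) ` (UNIV \<times> short_lists w m)"
    using length_le_cost [of ys]
    by (intro image_eqI [of _ _ "(e, ys)"]) (auto simp: short_lists_def)
qed

lemma finite_alt_ball [simp]: "finite (alt_ball w m)"
  by (rule finite_subset [OF alt_ball_subset]) auto

lemma finite_rooted_alt_ball [simp]: "finite (rooted_alt_ball w m n)"
  by (simp add: rooted_alt_ball_def)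

lemma card_alt_ball_le: "card (alt_ball w m) \<le> 2 * card (short_lists w m)"
proof -
  have "card (alt_ball w m) \<le> card ((UNIV :: bool set) \<times> short_lists w m)"
    by (rule surj_card_le [OF _ alt_ball_subset]) auto
  then show ?thesis by (simp add: card_cartesian_product card_UNIV_bool)
qed

lemma card_rooted_alt_ball: "card (rooted_alt_ball w m n) \<le> card (alt_ball w m) * card (box n)"
  unfolding rooted_alt_ball_def
  by (rule order_trans [OF card_image_le]) (auto simp: card_cartesian_product)

section \<open>Exponential estimates for the number of alternating words\<close>

text \<open>Raise \<open>1 + t \<le> exp t\<close> to the power \<open>d\<close> at
  \<open>t = \<epsilon> * n / d\<close>; the constant \<open>c\<close> is chosen so that
  \<open>n + 1 \<le> c * (1 + t)\<close>.\<close>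

lemma polynomial_le_exp:
  assumes "\<epsilon> > (0 :: real)"
  shows "\<exists>C > 0. \<forall>n :: nat. (real n + 1) ^ d \<le> C * exp (\<epsilon> * real n)"
proof (cases "d = 0")
  case True
  then show ?thesis using assms by (intro exI [of _ 1]) auto
next
  case False
  define c where "c = max 1 (real d / \<epsilon>)"
  have c: "c \<ge> 1" "c * (\<epsilon> / real d) \<ge> 1"
    using assms False by (auto simp: c_def max_def field_simps)
  have "(real n + 1) ^ d \<le> c ^ d * exp (\<epsilon> * real n)" for n :: nat
  proof -
    have "real n + 1 \<le> c + c * (\<epsilon> / real d) * real n"
      using c mult_right_mono [OF c(2), of "real n"] by simp
    also have "\<dots> = c * (1 + \<epsilon> * real n / real d)"
      by (simp add: algebra_simps)
    also have "\<dots> \<le> c * exp (\<epsilon> * real n / real d)"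
      using c by (intro mult_left_mono exp_ge_add_one_self) auto
    finally have "(real n + 1) ^ d \<le> (c * exp (\<epsilon> * real n / real d)) ^ d"
      by (intro power_mono) auto
    also have "\<dots> = c ^ d * exp (\<epsilon> * real n)"
      using False by (simp add: power_mult_distrib flip: exp_of_nat_mult)
    finally show ?thesis .
  qed
  then show ?thesis using c by (intro exI [of _ "c ^ d"]) auto
qed

text \<open>Group by norm. Half of \<open>\<theta>\<close> absorbs the polynomial size of the
  spheres, and the other half leaves a geometric series.\<close>

lemma box_exp_sum_bounded:
  assumes "\<theta> > (0 :: real)"
  shows "\<exists>C \<ge> 0. \<forall>m. (\<Sum>x\<in>box m. exp (- \<theta> * real (nrm x))) \<le> C"
proof -
  obtain C where C: "C > 0" "\<And>n. (real n + 1) ^ 6 \<le> C * exp (\<theta> / 2 * real n)"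
    using polynomial_le_exp [of "\<theta> / 2" 6] assms by auto
  define q where "q = exp (- \<theta> / 2)"
  have q: "0 < q" "q < 1" using assms by (auto simp: q_def)
  have q_pow: "q ^ j = exp (- \<theta> / 2 * real j)" for j
    by (simp add: q_def mult.commute flip: exp_of_nat_mult)
  have "(\<Sum>x\<in>box m. exp (- \<theta> * real (nrm x))) \<le> 64 * C * (1 / (1 - q))" for m
  proof -
    have "(\<Sum>x\<in>box m. exp (- \<theta> * real (nrm x)))
        = (\<Sum>j\<le>m. \<Sum>x\<in>{x \<in> box m. nrm x = j}. exp (- \<theta> * real (nrm x)))"
      by (rule sum.group [symmetric]) (auto simp: box_def [symmetric], simp add: box_def)
    also have "\<dots> \<le> (\<Sum>j\<le>m. 64 * C * q ^ j)"
    proof (rule sum_mono)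
      fix j
      have "(\<Sum>x\<in>{x \<in> box m. nrm x = j}. exp (- \<theta> * real (nrm x)))
          = real (card {x \<in> box m. nrm x = j}) * exp (- \<theta> * real j)"
        by simp
      also have "\<dots> \<le> real (card (box j)) * exp (- \<theta> * real j)"
        by (intro mult_right_mono of_nat_mono card_mono) (auto simp: box_def [of j], simp flip: box_def)
      also have "\<dots> \<le> 64 * (C * exp (\<theta> / 2 * real j)) * exp (- \<theta> * real j)"
        using card_box [of j] C(2) [of j] by (intro mult_right_mono) auto
      also have "\<dots> = 64 * C * q ^ j"
        by (simp add: q_pow field_simps flip: exp_add)
      finally show "(\<Sum>x\<in>{x \<in> box m. nrm x = j}. exp (- \<theta> * real (nrm x))) \<le> 64 * C * q ^ j" .
    qed
    also have "\<dots> = 64 * C * (\<Sum>j\<le>m. q ^ j)"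
      by (simp add: sum_distrib_left)
    also have "(\<Sum>j\<le>m. q ^ j) \<le> 1 / (1 - q)"
    proof -
      have "(\<Sum>j\<le>m. q ^ j) \<le> (\<Sum>j. q ^ j)"
        using q by (intro sum_le_suminf summable_geometric) auto
      then show ?thesis using q by (simp add: suminf_geometric)
    qed
    finally show ?thesis using C by simp
  qed
  then show ?thesis using C q by (intro exI [of _ "64 * C * (1 / (1 - q))"]) auto
qed

text \<open>Splitting off the first entry \<open>x\<close> gains the factor
  \<open>exp (- \<theta> * nrm x)\<close>, and these factors sum to at most \<open>D\<close>; the
  extra \<open>1\<close> in \<open>C\<close> accounts for the empty list.\<close>

lemma card_short_lists:
  assumes "\<theta> > 0"
  shows "\<exists>C \<ge> 1. \<forall>n m. real (card (short_lists n m)) \<le> C ^ n * exp (\<theta> * real m)"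
proof -
  obtain D where D: "D \<ge> 0" "\<And>m. (\<Sum>x\<in>box m. exp (- \<theta> * real (nrm x))) \<le> D"
    using box_exp_sum_bounded [OF assms] by blast
  define C where "C = 1 + D"
  have C: "C \<ge> 1" using D by (simp add: C_def)
  have "real (card (short_lists n m)) \<le> C ^ n * exp (\<theta> * real m)" for n m
  proof (induction n arbitrary: m)
    case 0
    have "short_lists 0 m \<subseteq> {[]}" by (auto simp: short_lists_def)
    then have "card (short_lists 0 m) \<le> card {[] :: heis list}" by (intro card_mono) auto
    then have "real (card (short_lists 0 m)) \<le> 1" by simp
    also have "1 \<le> exp (\<theta> * real m)" using assms by simp
    finally show ?case by simp
  next
    case (Suc n)
    have "card (short_lists (Suc n) m)
        \<le> card (insert [] (\<Union>x\<in>box m. (#) x ` short_lists n (m - nrm x)))"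
      by (intro card_mono short_lists_Suc) auto
    also have "\<dots> \<le> Suc (card (\<Union>x\<in>box m. (#) x ` short_lists n (m - nrm x)))"
      by (rule card_insert_le_m1) auto
    also have "card (\<Union>x\<in>box m. (#) x ` short_lists n (m - nrm x))
        \<le> (\<Sum>x\<in>box m. card ((#) x ` short_lists n (m - nrm x)))"
      by (rule card_UN_le) simp
    also have "\<dots> = (\<Sum>x\<in>box m. card (short_lists n (m - nrm x)))"
      by (intro sum.cong refl card_image) auto
    finally have "real (card (short_lists (Suc n) m))
        \<le> 1 + (\<Sum>x\<in>box m. real (card (short_lists n (m - nrm x))))"
      by (simp flip: of_nat_sum)
    also have "(\<Sum>x\<in>box m. real (card (short_lists n (m - nrm x))))
        \<le> (\<Sum>x\<in>box m. C ^ n * exp (\<theta> * real m) * exp (- \<theta> * real (nrm x)))"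
    proof (rule sum_mono)
      fix x
      assume x: "x \<in> box m"
      have "exp (\<theta> * real (m - nrm x)) = exp (\<theta> * real m) * exp (- \<theta> * real (nrm x))"
        using x by (simp add: box_def of_nat_diff algebra_simps flip: exp_add)
      then show "real (card (short_lists n (m - nrm x)))
          \<le> C ^ n * exp (\<theta> * real m) * exp (- \<theta> * real (nrm x))"
        using Suc [of "m - nrm x"] by (simp add: mult.assoc)
    qed
    also have "\<dots> = C ^ n * exp (\<theta> * real m) * (\<Sum>x\<in>box m. exp (- \<theta> * real (nrm x)))"
      by (simp add: sum_distrib_left)
    also have "\<dots> \<le> C ^ n * exp (\<theta> * real m) * D"
      using C D by (intro mult_left_mono) auto
    also have "1 + \<dots> \<le> C ^ n * exp (\<theta> * real m) + C ^ n * exp (\<theta> * real m) * D"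
    proof -
      have "1 * 1 \<le> C ^ n * exp (\<theta> * real m)"
        using C assms by (intro mult_mono) auto
      then show ?thesis by simp
    qed
    also have "\<dots> = C ^ Suc n * exp (\<theta> * real m)"
      by (simp add: C_def algebra_simps)
    finally show ?case by simp
  qed
  then show ?thesis using C by blast
qed

text \<open>\<open>\<theta>\<close> is kept fixed while passing to components contracts \<open>\<kappa>\<close>.\<close>

definition growth_rate :: "real \<Rightarrow> real \<Rightarrow> bool" where
  "growth_rate \<theta> \<kappa> \<longleftrightarrow> (\<exists>A d. \<forall>w m. real (card (alt_ball w m))
     \<le> A * (real (m + w) + 1) ^ d * exp (\<theta> * real m + \<kappa> * real w))"

text \<open>The cost bounds the length of a list, so the factor \<open>C ^ w\<close> for lists
  serves with \<open>\<kappa> = ln C\<close>.\<close>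

lemma growth_rate_ex:
  assumes "\<theta> > 0"
  shows "\<exists>\<kappa> \<ge> 0. growth_rate \<theta> \<kappa>"
proof -
  obtain C where C: "C \<ge> 1" "\<And>n m. real (card (short_lists n m)) \<le> C ^ n * exp (\<theta> * real m)"
    using card_short_lists [OF assms] by blast
  have "real (card (alt_ball w m)) \<le> 2 * (real (m + w) + 1) ^ 0 * exp (\<theta> * real m + ln C * real w)"
    for w m
  proof -
    have "real (card (alt_ball w m)) \<le> 2 * (C ^ w * exp (\<theta> * real m))"
      using card_alt_ball_le [of w m] C(2) [of w m] by linarith
    also have "C ^ w = exp (ln C * real w)"
      using C(1) by (simp add: mult.commute exp_of_nat_mult)
    finally show ?thesis by (simp add: exp_add mult.commute)
  qed
  then have "growth_rate \<theta> (ln C)"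
    unfolding growth_rate_def by blast
  then show ?thesis
    using C(1) by (intro exI [of _ "ln C"]) auto
qed

text \<open>Elements of \<open>alt_ball\<close> have root label \<open>0\<close> and are determined
  by their components. Multiplying the bounds for the components adds the exponents:
  \<open>m0 + m1 \<le> m\<close> preserves \<open>\<theta>\<close>, while
  \<open>w0 + w1 \<le> 6 + 8 / 9 * w\<close> shrinks \<open>\<kappa>\<close>.\<close>

lemma growth_rate_contract:
  assumes "growth_rate \<theta> \<kappa>" "\<theta> \<ge> 0" "\<kappa> \<ge> 0"
  shows "growth_rate \<theta> (8 / 9 * \<kappa>)"
proof -
  obtain A' d where A': "\<And>w m. real (card (alt_ball w m))
      \<le> A' * (real (m + w) + 1) ^ d * exp (\<theta> * real m + \<kappa> * real w)"
    using assms(1) by (auto simp: growth_rate_def)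
  define A where "A = max A' 0"
  have A: "real (card (alt_ball w m))
      \<le> A * (real (m + w) + 1) ^ d * exp (\<theta> * real m + \<kappa> * real w)" for w m
    by (rule order_trans [OF A']) (auto simp: A_def intro!: mult_right_mono)
  have A0: "A \<ge> 0" by (simp add: A_def)
  define B where "B = A\<^sup>2 * 7 ^ (2 * d) * exp (6 * \<kappa>) * 64\<^sup>2 * 7\<^sup>2"
  \<comment> \<open>In the exponent \<open>2 * d + 16\<close>, the number of splittings in
    \<open>I\<close> contributes \<open>4\<close> and the two boxes of rooted parts contribute
    \<open>12\<close>.\<close>
  have "real (card (alt_ball w m))
      \<le> B * (real (m + w) + 1) ^ (2 * d + 16) * exp (\<theta> * real m + 8 / 9 * \<kappa> * real w)" for w m
  proof -
    define N where "N = real (m + w) + 1"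
    have N: "N \<ge> 1" by (simp add: N_def)
    define I where "I = {(w0, m0, w1, m1). 9 * (w0 + w1) \<le> 54 + 8 * w \<and> m0 + m1 \<le> m}"
    have I_sub: "I \<subseteq> {..w + 6} \<times> {..m} \<times> {..w + 6} \<times> {..m}"
      by (auto simp: I_def)
    then have fin_I: "finite I" by (rule finite_subset) auto
    have "card I \<le> card ({..w + 6} \<times> {..m} \<times> {..w + 6} \<times> {..m})"
      using I_sub by (rule card_mono [rotated]) auto
    then have "card I \<le> (w + 7) * (m + 1) * ((w + 7) * (m + 1))"
      by (simp add: card_cartesian_product algebra_simps)
    then have "real (card I) \<le> real ((w + 7) * (m + 1) * ((w + 7) * (m + 1)))"
      by (rule of_nat_mono)
    also have "\<dots> = (real w + 7) * (real m + 1) * ((real w + 7) * (real m + 1))"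
      by (simp add: algebra_simps)
    also have "\<dots> \<le> (7 * N) * N * ((7 * N) * N)"
      by (intro mult_mono) (auto simp: N_def)
    finally have card_I: "real (card I) \<le> 7\<^sup>2 * N ^ 4"
      by (simp add: power2_eq_square power4_eq_xxxx algebra_simps)
    have box: "real (card (box m)) \<le> 64 * N ^ 6"
      by (rule order_trans [OF card_box]) (auto simp: N_def intro!: power_mono)
    define U where "U = (\<lambda>(w0, m0, w1, m1). rooted_alt_ball w0 m0 m \<times> rooted_alt_ball w1 m1 m)"
    have inj: "inj_on (\<lambda>g. (sub g False, sub g True)) (alt_ball w m)"
    proof (rule inj_onI, rule portrait_eqI)
      fix g h c
      assume gh: "g \<in> alt_ball w m" "h \<in> alt_ball w m" 
        "(sub g False, sub g True) = (sub h False, sub h True)"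
      show "lab g = lab h" using gh by (auto simp: alt_ball_def)
      show "sub g c = sub h c" using gh by (cases c) auto
    qed
    have "(\<lambda>g. (sub g False, sub g True)) ` alt_ball w m \<subseteq> (\<Union>i\<in>I. U i)"
    proof (rule image_subsetI)
      fix g
      assume "g \<in> alt_ball w m"
      then obtain w0 m0 w1 m1 where i: "(w0, m0, w1, m1) \<in> I"
        "(sub g False, sub g True) \<in> U (w0, m0, w1, m1)"
        using sub_alt_ball [of g w m] by (auto simp: I_def U_def)
      then show "(sub g False, sub g True) \<in> (\<Union>i\<in>I. U i)" by blast
    qed
    then have "card ((\<lambda>g. (sub g False, sub g True)) ` alt_ball w m) \<le> card (\<Union>i\<in>I. U i)"
      using fin_I by (intro card_mono) (auto simp: U_def)
    then have "card (alt_ball w m) \<le> card (\<Union>i\<in>I. U i)"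
      by (simp add: card_image [OF inj])
    also have "\<dots> \<le> (\<Sum>i\<in>I. card (U i))"
      by (rule card_UN_le [OF fin_I])
    finally have "real (card (alt_ball w m)) \<le> (\<Sum>i\<in>I. real (card (U i)))"
      by (simp flip: of_nat_sum)
    also have "\<dots> \<le> (\<Sum>i\<in>I. A\<^sup>2 * (7 * N) ^ (2 * d)
        * (exp (6 * \<kappa>) * exp (\<theta> * real m + 8 / 9 * \<kappa> * real w)) * (64 * N ^ 6)\<^sup>2)"
    proof (rule sum_mono)
      fix i
      assume "i \<in> I"
      then obtain w0 m0 w1 m1 where i: "i = (w0, m0, w1, m1)"
        and w: "9 * (w0 + w1) \<le> 54 + 8 * w" and m: "m0 + m1 \<le> m"
        by (auto simp: I_def)
      define E where "E = (\<lambda>w m. exp (\<theta> * real m + \<kappa> * real w))"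
      have part: "real (card (rooted_alt_ball w' m' m)) \<le> A * (7 * N) ^ d * E w' m' * (64 * N ^ 6)"
        if "w' \<le> w + 6" "m' \<le> m" for w' m'
      proof -
        have "real (card (rooted_alt_ball w' m' m)) \<le> real (card (alt_ball w' m')) * real (card (box m))"
          using card_rooted_alt_ball [of w' m' m] by (simp flip: of_nat_mult)
        also have "\<dots> \<le> (A * (real (m' + w') + 1) ^ d * E w' m') * (64 * N ^ 6)"
          using A [of w' m'] A0 box by (intro mult_mono) (auto simp: E_def)
        also have "\<dots> \<le> (A * (7 * N) ^ d * E w' m') * (64 * N ^ 6)"
          using that A0 N
          by (intro mult_mono power_mono order_refl) (auto simp: E_def N_def)
        finally show ?thesis .
      qed
      have "real (card (U i)) = real (card (rooted_alt_ball w0 m0 m)) * real (card (rooted_alt_ball w1 m1 m))"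
        by (simp add: U_def i card_cartesian_product)
      also have "\<dots> \<le> (A * (7 * N) ^ d * E w0 m0 * (64 * N ^ 6)) * (A * (7 * N) ^ d * E w1 m1 * (64 * N ^ 6))"
        using w m A0 N by (intro mult_mono part) (auto simp: E_def)
      also have "\<dots> = A\<^sup>2 * (7 * N) ^ (2 * d) * (E w0 m0 * E w1 m1) * (64 * N ^ 6)\<^sup>2"
      proof -
        have "(a * p * e * b) * (a * p * e' * b) = a\<^sup>2 * (p * p) * (e * e') * b\<^sup>2"
          for a p e e' b :: real
          by (simp add: power2_eq_square)
        from this [of A "(7 * N) ^ d" "E w0 m0" "64 * N ^ 6" "E w1 m1"] show ?thesis
          by (simp only: mult_2 power_add)
      qed
      also have "\<dots> \<le> A\<^sup>2 * (7 * N) ^ (2 * d)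
          * (exp (6 * \<kappa>) * exp (\<theta> * real m + 8 / 9 * \<kappa> * real w)) * (64 * N ^ 6)\<^sup>2"
      proof -
        have "real (m0 + m1) \<le> real m" using m by (rule of_nat_mono)
        then have "\<theta> * (real m0 + real m1) \<le> \<theta> * real m"
          using assms(2) by (intro mult_left_mono) auto
        moreover have "real w0 + real w1 \<le> 6 + 8 / 9 * real w"
          using of_nat_mono [OF w, where 'a = real] by simp
        then have "\<kappa> * (real w0 + real w1) \<le> \<kappa> * (6 + 8 / 9 * real w)"
          using assms(3) by (intro mult_left_mono) auto
        ultimately have "E w0 m0 * E w1 m1 \<le> exp (6 * \<kappa>) * exp (\<theta> * real m + 8 / 9 * \<kappa> * real w)"
          by (simp add: E_def algebra_simps flip: exp_add)
        then show ?thesis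
          using N by (intro mult_left_mono mult_right_mono) auto
      qed
      finally show "real (card (U i)) \<le> A\<^sup>2 * (7 * N) ^ (2 * d)
          * (exp (6 * \<kappa>) * exp (\<theta> * real m + 8 / 9 * \<kappa> * real w)) * (64 * N ^ 6)\<^sup>2" .
    qed
    also have "\<dots> = real (card I) * (A\<^sup>2 * (7 * N) ^ (2 * d)
        * (exp (6 * \<kappa>) * exp (\<theta> * real m + 8 / 9 * \<kappa> * real w)) * (64 * N ^ 6)\<^sup>2)"
      by simp
    also have "\<dots> \<le> 7\<^sup>2 * N ^ 4 * (A\<^sup>2 * (7 * N) ^ (2 * d)
        * (exp (6 * \<kappa>) * exp (\<theta> * real m + 8 / 9 * \<kappa> * real w)) * (64 * N ^ 6)\<^sup>2)"
      using card_I N by (intro mult_right_mono) auto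
    also have "\<dots> = B * N ^ (2 * d + 16) * exp (\<theta> * real m + 8 / 9 * \<kappa> * real w)"
    proof -
      have "N ^ (2 * d + 16) = N ^ 4 * N ^ (2 * d) * (N ^ 6)\<^sup>2"
        by (simp add: add.commute flip: power_add power_mult)
      then show ?thesis
        by (simp add: B_def power_mult_distrib)
    qed
    finally show ?thesis by (simp add: N_def)
  qed
  then show ?thesis unfolding growth_rate_def by blast
qed

text \<open>Each contraction worsens the polynomial factor, but for a given
  \<open>\<epsilon>\<close> finitely many contractions suffice.\<close>

lemma growth_rate_small:
  assumes "\<theta> > 0" "\<epsilon> > 0"
  shows "\<exists>\<kappa> \<ge> 0. \<kappa> \<le> \<epsilon> \<and> growth_rate \<theta> \<kappa>"
proof -
  obtain \<kappa> where \<kappa>: "\<kappa> \<ge> 0" "growth_rate \<theta> \<kappa>"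
    using growth_rate_ex [OF assms(1)] by blast
  have *: "growth_rate \<theta> ((8 / 9) ^ n * \<kappa>)" for n
  proof (induction n)
    case (Suc n)
    then show ?case
      using growth_rate_contract [OF Suc] assms(1) \<kappa>(1) by (simp add: mult.assoc)
  qed (simp add: \<kappa>)
  obtain n where "(8 / 9) ^ n < \<epsilon> / (\<kappa> + 1)"
    using real_arch_pow_inv [of "\<epsilon> / (\<kappa> + 1)" "8 / 9"] assms(2) \<kappa>(1) by auto
  then have "(8 / 9) ^ n * (\<kappa> + 1) < \<epsilon>"
    using \<kappa>(1) by (simp add: pos_less_divide_eq)
  moreover have "(8 / 9) ^ n * \<kappa> \<le> (8 / 9) ^ n * (\<kappa> + 1)"
    by (intro mult_left_mono) auto
  ultimately have "(8 / 9) ^ n * \<kappa> \<le> \<epsilon>" by linarith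
  then show ?thesis
    using * [of n] \<kappa>(1) by (intro exI [of _ "(8 / 9) ^ n * \<kappa>"]) auto
qed

section \<open>Word balls for a finite generating set and their subexponential size\<close>

definition basis :: "heis set" where
  "basis = {Heis 1 0 0 0 0, Heis 0 1 0 0 0, Heis 0 0 1 0 0, Heis 0 0 0 1 0, Heis 0 0 0 0 1}"

definition signed_basis :: "heis set" where
  "signed_basis = basis \<union> uminus ` basis"

lemma finite_basis: "finite basis"
  by (simp add: basis_def)

lemma finite_signed_basis: "finite signed_basis"
  by (simp add: signed_basis_def finite_basis)

lemma nrm_signed_basis:
  assumes "h \<in> signed_basis"
  shows "nrm h \<le> 1"
  using assms unfolding nrm_le_iff by (auto simp: signed_basis_def basis_def)

lemma additive_int_image:
  fixes f :: "int \<Rightarrow> heis"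
  assumes "\<And>a b. a \<in> Q \<Longrightarrow> b \<in> Q \<Longrightarrow> a + b \<in> Q" "0 \<in> Q"
    and "\<And>i j. f (i + j) = f i + f j" "f 1 \<in> Q" "f (- 1) \<in> Q"
  shows "f i \<in> Q"
proof (induction i rule: int_induct [where k = 0])
  case base
  have "f 0 = 0" using assms(3) [of 0 0] by (metis add.right_neutral add_left_imp_eq)
  then show ?case using assms(2) by simp
next
  case (step1 i)
  then show ?case using assms by simp
next
  case (step2 i)
  then show ?case using assms(1) [OF _ assms(5), of "f i"] assms(3) [of i "- 1"] by simp
qed

lemma signed_basis_generates:
  assumes add: "\<And>a b. a \<in> Q \<Longrightarrow> b \<in> Q \<Longrightarrow> a + b \<in> Q" and zero: "0 \<in> Q"
    and basis: "signed_basis \<subseteq> Q"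
  shows "h \<in> Q"
proof -
  obtain x y u v z where h: "h = Heis x y u v z" by (cases h)
  have "Heis x 0 0 0 0 \<in> Q" "Heis 0 y 0 0 0 \<in> Q" "Heis 0 0 u 0 0 \<in> Q" "Heis 0 0 0 v 0 \<in> Q"
    "Heis 0 0 0 0 t \<in> Q" for t
    using basis
      additive_int_image [OF add zero, of "\<lambda>i. Heis i 0 0 0 0" x]
      additive_int_image [OF add zero, of "\<lambda>i. Heis 0 i 0 0 0" y]
      additive_int_image [OF add zero, of "\<lambda>i. Heis 0 0 i 0 0" u]
      additive_int_image [OF add zero, of "\<lambda>i. Heis 0 0 0 i 0" v]
      additive_int_image [OF add zero, of "\<lambda>i. Heis 0 0 0 0 i" t]
    by (auto simp: signed_basis_def basis_def)
  \<comment> \<open>The last summand cancels the values \<open>x * y\<close> and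
    \<open>u * v\<close> that the cocycle adds to the central coordinate.\<close>
  then have "Heis x 0 0 0 0 + Heis 0 y 0 0 0 + Heis 0 0 u 0 0 + Heis 0 0 0 v 0
      + Heis 0 0 0 0 (z - x * y - u * v) \<in> Q"
    by (intro add)
  then show ?thesis by (simp add: h)
qed

definition word_ball :: "nat \<Rightarrow> portrait set" where
  "word_ball n = {eval_word ws | ws. length ws \<le> n \<and> set ws \<subseteq> UNIV \<times> signed_basis}"

lemma word_ball_subset_Gam: "word_ball n \<subseteq> Gam"
  by (auto simp: word_ball_def Gam_def)

lemma word_ball_zero: "0 \<in> word_ball n"
  unfolding word_ball_def by (auto intro!: exI [of _ "[]"])

lemma word_ball_add:
  assumes "g \<in> word_ball m" "h \<in> word_ball n"
  shows "g + h \<in> word_ball (m + n)"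
proof -
  obtain ws vs where "g = eval_word ws" "length ws \<le> m" "set ws \<subseteq> UNIV \<times> signed_basis"
    "h = eval_word vs" "length vs \<le> n" "set vs \<subseteq> UNIV \<times> signed_basis"
    using assms by (auto simp: word_ball_def)
  then show ?thesis
    unfolding word_ball_def by (intro CollectI exI [of _ "ws @ vs"]) auto
qed

lemma word_ball_mono: "m \<le> n \<Longrightarrow> word_ball m \<subseteq> word_ball n"
  unfolding word_ball_def by fastforce

lemma finite_word_ball [simp]: "finite (word_ball n)"
proof -
  have "word_ball n \<subseteq> eval_word ` {ws. set ws \<subseteq> UNIV \<times> signed_basis \<and> length ws \<le> n}"
    by (auto simp: word_ball_def)
  then show ?thesis
    by (rule finite_subset)
       (intro finite_imageI finite_lists_length_le finite_cartesian_product finite_signed_basis finite_UNIV)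
qed

lemma Gam_word_ball:
  assumes "g \<in> Gam"
  shows "\<exists>n. g \<in> word_ball n"
proof -
  have letter: "\<exists>n. letter (b, h) \<in> word_ball n" for b h
  proof -
    have "h \<in> {h. \<exists>n. letter (b, h) \<in> word_ball n}"
    proof (rule signed_basis_generates)
      fix h k
      assume "h \<in> {h. \<exists>n. letter (b, h) \<in> word_ball n}" "k \<in> {h. \<exists>n. letter (b, h) \<in> word_ball n}"
      moreover have "letter (b, h + k) = letter (b, h) + letter (b, k)"
        by (simp add: directed_add rooted_add)
      ultimately show "h + k \<in> {h. \<exists>n. letter (b, h) \<in> word_ball n}"
        using word_ball_add by fastforce
    next
      have "letter (b, 0) = 0" by simp
      then show "0 \<in> {h. \<exists>n. letter (b, h) \<in> word_ball n}"
        using word_ball_zero by (metis mem_Collect_eq)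
    next
      have "letter (b, h) \<in> word_ball 1" if "h \<in> signed_basis" for h
        unfolding word_ball_def using that by (intro CollectI exI [of _ "[(b, h)]"]) auto
      then show "signed_basis \<subseteq> {h. \<exists>n. letter (b, h) \<in> word_ball n}" by blast
    qed
    then show ?thesis by simp
  qed
  have "\<exists>n. eval_word ws \<in> word_ball n" for ws
  proof (induction ws)
    case Nil
    then show ?case using word_ball_zero by auto
  next
    case (Cons l ws)
    obtain m where "letter l \<in> word_ball m" using letter by (cases l) blast
    then show ?case using Cons word_ball_add by fastforce
  qed
  then show ?thesis using assms by (auto simp: Gam_def)
qed

text \<open>Each letter costs at most \<open>6\<close>, and the normal form adds at most
  \<open>3\<close>.\<close>

lemma word_ball_subset_alt_ball: "word_ball n \<subseteq> rooted_alt_ball (6 * n + 3) n n"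
proof
  fix g
  assume "g \<in> word_ball n"
  then obtain ws where g: "g = eval_word ws" and len: "length ws \<le> n"
    and ws: "set ws \<subseteq> UNIV \<times> signed_basis" by (auto simp: word_ball_def)
  have "sum_list (map letter_cost ws) \<le> 6 * length ws \<and>
    sum_list (map directed_nrm ws) \<le> length ws \<and>
    sum_list (map rooted_nrm ws) \<le> length ws"
    using ws
  proof (induction ws)
    case (Cons l ws)
    obtain b h where l: "l = (b, h)" by (cases l)
    have ws: "set ws \<subseteq> UNIV \<times> signed_basis" and "nrm h \<le> 1"
      using Cons.prems nrm_signed_basis by (auto simp: l)
    then show ?case
      using Cons.IH [OF ws] weight_le [of h] by (auto simp: l)
  qed simp
  then show "g \<in> rooted_alt_ball (6 * n + 3) n n"
    using word_normal_form [of ws] len unfolding g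
    by (auto split: if_splits intro!: rooted_alt_ballI)
qed

lemma word_ball_subexponential:
  assumes "s > (0 :: real)"
  shows "\<exists>C > 0. \<forall>n. real (card (word_ball n)) \<le> C * exp (s * real n)"
proof -
  \<comment> \<open>The exponent \<open>s\<close> is split in three: \<open>s / 3\<close> for the
    norm, \<open>6 * \<kappa> \<le> s / 3\<close> for the cost \<open>6 * n + 3\<close>, and
    \<open>s / 3\<close> to absorb the polynomial factors.\<close>
  obtain \<kappa> where \<kappa>: "\<kappa> \<ge> 0" "\<kappa> \<le> s / 18" "growth_rate (s / 3) \<kappa>"
    using growth_rate_small [of "s / 3" "s / 18"] assms by auto
  obtain A' d where A': "\<And>w m. real (card (alt_ball w m))
      \<le> A' * (real (m + w) + 1) ^ d * exp (s / 3 * real m + \<kappa> * real w)"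
    using \<kappa>(3) by (auto simp: growth_rate_def)
  define A where "A = max A' 1"
  have A: "real (card (alt_ball w m))
      \<le> A * (real (m + w) + 1) ^ d * exp (s / 3 * real m + \<kappa> * real w)" for w m
    by (rule order_trans [OF A']) (auto simp: A_def intro!: mult_right_mono)
  have A1: "A \<ge> 1" by (simp add: A_def)
  obtain C where C: "C > 0" "\<And>n. (real n + 1) ^ (d + 6) \<le> C * exp (s / 3 * real n)"
    using polynomial_le_exp [of "s / 3" "d + 6"] assms by auto
  have "real (card (word_ball n)) \<le> A * 7 ^ d * exp (3 * \<kappa>) * 64 * C * exp (s * real n)" for n
  proof -
    have "card (word_ball n) \<le> card (rooted_alt_ball (6 * n + 3) n n)"
      by (intro card_mono word_ball_subset_alt_ball) simp
    also have "\<dots> \<le> card (alt_ball (6 * n + 3) n) * card (box n)"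
      by (rule card_rooted_alt_ball)
    finally have "real (card (word_ball n)) \<le> real (card (alt_ball (6 * n + 3) n)) * real (card (box n))"
      by (simp flip: of_nat_mult)
    also have "\<dots> \<le> (A * (real (n + (6 * n + 3)) + 1) ^ d * exp (s / 3 * real n + \<kappa> * real (6 * n + 3)))
        * (64 * (real n + 1) ^ 6)"
      using A1 by (intro mult_mono A card_box) auto
    also have "\<dots> \<le> (A * (7 * (real n + 1)) ^ d * (exp (3 * \<kappa>) * exp (2 / 3 * s * real n)))
        * (64 * (real n + 1) ^ 6)"
    proof -
      have "6 * \<kappa> * real n \<le> s / 3 * real n"
        using \<kappa>(2) by (intro mult_right_mono) auto
      then have "s / 3 * real n + \<kappa> * real (6 * n + 3) \<le> 3 * \<kappa> + 2 / 3 * s * real n"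
        by (simp add: algebra_simps)
      then have "exp (s / 3 * real n + \<kappa> * real (6 * n + 3)) \<le> exp (3 * \<kappa>) * exp (2 / 3 * s * real n)"
        by (simp flip: exp_add)
      moreover have "(real (n + (6 * n + 3)) + 1) ^ d \<le> (7 * (real n + 1)) ^ d"
        by (intro power_mono) auto
      ultimately show ?thesis
        using A1 by (intro mult_right_mono mult_mono) auto
    qed
    also have "\<dots> = A * 7 ^ d * exp (3 * \<kappa>) * 64 * exp (2 / 3 * s * real n) * (real n + 1) ^ (d + 6)"
      by (simp only: power_mult_distrib power_add mult_ac)
    also have "\<dots> \<le> A * 7 ^ d * exp (3 * \<kappa>) * 64 * exp (2 / 3 * s * real n) * (C * exp (s / 3 * real n))"
      using A1 C(2) [of n] by (intro mult_left_mono) auto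
    also have "\<dots> = A * 7 ^ d * exp (3 * \<kappa>) * 64 * C * exp (s * real n)"
    proof -
      have "exp (2 / 3 * s * real n) * exp (s / 3 * real n) = exp (s * real n)"
        by (simp add: field_simps flip: exp_add)
      then show ?thesis by (simp add: mult_ac)
    qed
    finally show ?thesis .
  qed
  then show ?thesis
    using A1 C(1) by (intro exI [of _ "A * 7 ^ d * exp (3 * \<kappa>) * 64 * C"]) auto
qed

lemma root_tendsto_1:
  fixes f :: "nat \<Rightarrow> real"
  assumes ge: "\<And>n. f n \<ge> 1"
    and le: "\<And>s. s > 0 \<Longrightarrow> \<exists>C > 0. \<forall>n. f n \<le> C * exp (s * real n)"
  shows "(\<lambda>n. root n (f n)) \<longlonglongrightarrow> 1"
proof (rule order_tendstoI)
  fix a :: real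
  assume "a < 1"
  have "a < root n (f n)" if "n > 0" for n
    using that ge [of n] \<open>a < 1\<close> real_root_ge_1_iff [of n "f n"] by linarith
  then show "eventually (\<lambda>n. a < root n (f n)) sequentially"
    by (rule eventually_mono [OF eventually_gt_at_top])
next
  fix a :: real
  assume a: "1 < a"
  define s where "s = ln a / 2"
  have s: "s > 0" using a by (simp add: s_def)
  then have "exp s < exp (ln a)" by (simp add: s_def)
  also have "exp (ln a) = a" using a by simp
  finally have "exp s < a" .
  obtain C where C: "C > 0" "\<And>n. f n \<le> C * exp (s * real n)" using le [OF s] by blast
  have "(\<lambda>n. root n C * exp s) \<longlonglongrightarrow> 1 * exp s"
    using C(1) by (intro tendsto_intros LIMSEQ_root_const)
  then have "eventually (\<lambda>n. root n C * exp s < a) sequentially"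
    using \<open>exp s < a\<close> by (intro order_tendstoD(2)) auto
  then show "eventually (\<lambda>n. root n (f n) < a) sequentially"
    using eventually_gt_at_top [of 0]
  proof eventually_elim
    case (elim n)
    have "root n (f n) \<le> root n (C * exp (s * real n))"
      using C(2) [of n] elim by simp
    also have "\<dots> = root n C * root n (exp s ^ n)"
      by (simp add: real_root_mult mult.commute flip: exp_of_nat_mult)
    also have "\<dots> = root n C * exp s"
      using elim by (simp add: real_root_power_cancel)
    finally show ?case using elim by simp
  qed
qed

lemma word_ball_root: "(\<lambda>n. root n (real (card (word_ball n)))) \<longlonglongrightarrow> 1"
proof (rule root_tendsto_1)
  have "card (word_ball n) > 0" for n
    using word_ball_zero [of n] by (auto simp: card_gt_0_iff)
  then show "real (card (word_ball n)) \<ge> 1" for n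
    by (simp add: Suc_leI)
qed (rule word_ball_subexponential)

section \<open>Superpolynomial growth from the center\<close>

text \<open>The central elements supported on the first \<open>d\<close> levels with values in
  \<open>{0..N}\<close> are distinct, and their word length is linear in \<open>N\<close> for fixed
  \<open>d\<close>.\<close>

lemma card_word_ball_ge: "\<exists>c > 0. \<forall>N. (N + 1) ^ d \<le> card (word_ball (N * c))"
proof -
  have "\<exists>c. level_const (\<lambda>k. if k = i then 1 else 0) \<in> word_ball c" for i
    by (intro Gam_word_ball level_const_single_Gam)
  then obtain c where c: "\<And>i. level_const (\<lambda>k. if k = i then 1 else 0) \<in> word_ball (c i)"
    by metis
  have single: "level_const (\<lambda>k. if k = i then int n else 0) \<in> word_ball (n * c i)" for i n
  proof (induction n)
    case 0
    have "(\<lambda>k. if k = i then int 0 else 0) = (\<lambda>k. 0)" by auto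
    then show ?case using word_ball_zero by (simp only: level_const_zero)
  next
    case (Suc n)
    have "(\<lambda>k. if k = i then int (Suc n) else 0)
        = (\<lambda>k. (if k = i then 1 else 0) + (if k = i then int n else 0))"
      by auto
    then show ?case
      using word_ball_add [OF c [of i] Suc] by (simp add: level_const_add)
  qed
  have level_const_ball: "level_const (\<lambda>k. if k < m then p k else 0) \<in> word_ball (N * (\<Sum>i<m. c i))"
    if "\<And>i. i < m \<Longrightarrow> p i \<in> {0..int N}" for m N p
    using that
  proof (induction m)
    case 0
    then show ?case using word_ball_zero by simp
  next
    case (Suc m)
    define n where "n = nat (p m)"
    have n: "p m = int n" "n \<le> N" using Suc.prems [of m] by (auto simp: n_def)
    have "(\<lambda>k. if k < Suc m then p k else 0)
        = (\<lambda>k. (if k < m then p k else 0) + (if k = m then int n else 0))"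
      using n by (auto simp: less_Suc_eq)
    then have "level_const (\<lambda>k. if k < Suc m then p k else 0) \<in> word_ball (N * (\<Sum>i<m. c i) + n * c m)"
      using word_ball_add [OF Suc.IH single [of m n]] Suc.prems by (simp add: level_const_add)
    also have "\<dots> \<subseteq> word_ball (N * (\<Sum>i<Suc m. c i))"
      using n by (intro word_ball_mono) (simp add: distrib_left)
    finally show ?case .
  qed
  \<comment> \<open>The summand \<open>1\<close> makes \<open>C\<close> positive even for
    \<open>d = 0\<close>.\<close>
  define C where "C = (\<Sum>i<d. c i) + 1"
  have "(N + 1) ^ d \<le> card (word_ball (N * C))" for N
  proof -
    let ?P = "PiE {..<d} (\<lambda>_. {0..int N})"
    let ?f = "\<lambda>p. level_const (\<lambda>k. if k < d then p k else 0)"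
    have inj: "inj_on ?f ?P"
    proof (rule inj_onI)
      fix p q
      assume pq: "p \<in> ?P" "q \<in> ?P" "?f p = ?f q"
      show "p = q"
      proof (rule PiE_ext [OF pq(1,2)])
        fix i
        assume "i \<in> {..<d}"
        then show "p i = q i"
          using arg_cong [OF pq(3), of "spine i"] by simp
      qed
    qed
    have "?f ` ?P \<subseteq> word_ball (N * (\<Sum>i<d. c i))"
      by (intro image_subsetI level_const_ball) (auto simp: PiE_iff)
    also have "\<dots> \<subseteq> word_ball (N * C)"
      by (intro word_ball_mono) (simp add: C_def)
    finally have "card ?P \<le> card (word_ball (N * C))"
      using inj by (intro card_inj_on_le) auto
    then show ?thesis by (simp add: card_PiE nat_add_distrib)
  qed
  then show ?thesis by (intro exI [of _ C]) (auto simp: C_def)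
qed

lemma poly_le_power:
  fixes p :: "real poly"
  assumes "x \<ge> 1"
  shows "poly p x \<le> (\<Sum>i\<le>degree p. \<bar>coeff p i\<bar>) * x ^ degree p"
proof -
  have "poly p x = (\<Sum>i\<le>degree p. coeff p i * x ^ i)"
    by (rule poly_altdef)
  also have "\<dots> \<le> (\<Sum>i\<le>degree p. \<bar>coeff p i\<bar> * x ^ degree p)"
    using assms by (intro sum_mono mult_mono power_increasing) auto
  finally show ?thesis by (simp add: sum_distrib_right)
qed

lemma word_ball_superpolynomial:
  "\<not> (\<exists>p :: real poly. \<forall>n. real (card (word_ball n)) \<le> poly p (real n))"
proof
  assume "\<exists>p :: real poly. \<forall>n. real (card (word_ball n)) \<le> poly p (real n)"
  then obtain p :: "real poly" where p: "\<And>n. real (card (word_ball n)) \<le> poly p (real n)" by blast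
  define D where "D = degree p"
  define B where "B = (\<Sum>i\<le>D. \<bar>coeff p i\<bar>)"
  have B: "B \<ge> 0" by (simp add: B_def sum_nonneg)
  \<comment> \<open>An exponent one above the degree of \<open>p\<close> contradicts the bound along
    the multiples of \<open>c\<close>.\<close>
  obtain c where c: "c > 0" "\<And>N. (N + 1) ^ Suc D \<le> card (word_ball (N * c))"
    using card_word_ball_ge [of "Suc D"] by blast
  obtain N :: nat where N: "real N > B * real c ^ D" using reals_Archimedean2 by blast
  have "0 \<le> B * real c ^ D" using B by simp
  then have N0: "N > 0" using N by (cases N) auto
  have "real (N + 1) ^ Suc D \<le> real (card (word_ball (N * c)))"
    using c(2) [of N] by (metis of_nat_mono of_nat_power)
  also have "\<dots> \<le> poly p (real (N * c))" by (rule p)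
  also have "\<dots> \<le> B * real (N * c) ^ D"
  proof -
    have "1 \<le> N * c" using N0 c(1) by (simp add: Suc_leI)
    then have "real 1 \<le> real (N * c)" by (rule of_nat_mono)
    then show ?thesis unfolding B_def D_def by (intro poly_le_power) simp
  qed
  also have "\<dots> = (B * real c ^ D) * real N ^ D"
    by (simp add: power_mult_distrib)
  also have "\<dots> < real N * real N ^ D"
    using N N0 by (intro mult_strict_right_mono) auto
  also have "\<dots> \<le> real (N + 1) ^ Suc D"
    by (simp add: power_mono mult_mono)
  finally show False by simp
qed

subsection \<open>Transfer to the natural numbers\<close>

text \<open>The countable set \<open>Gam\<close> is transported along an injection into
  \<open>nat\<close>, since the theorem asks for a carrier of natural numbers.\<close>

definition enc :: "portrait \<Rightarrow> nat" where
  "enc = to_nat_on Gam"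

definition dec :: "nat \<Rightarrow> portrait" where
  "dec = from_nat_into Gam"

definition Gamma :: "nat monoid" where
  "Gamma = \<lparr>carrier = enc ` Gam, monoid.mult = (\<lambda>a b. enc (dec a + dec b)), one = enc 0\<rparr>"

lemma dec_enc [simp]: "g \<in> Gam \<Longrightarrow> dec (enc g) = g"
  by (simp add: dec_def enc_def countable_Gam)

lemma inj_enc: "inj_on enc Gam"
  by (metis inj_on_inverseI dec_enc)

lemma enc_eq_iff: "g \<in> Gam \<Longrightarrow> h \<in> Gam \<Longrightarrow> enc g = enc h \<longleftrightarrow> g = h"
  by (metis dec_enc)

lemma carrier_Gamma: "carrier Gamma = enc ` Gam"
  and one_Gamma: "\<one>\<^bsub>Gamma\<^esub> = enc 0"
  and mult_Gamma: "g \<in> Gam \<Longrightarrow> h \<in> Gam \<Longrightarrow> enc g \<otimes>\<^bsub>Gamma\<^esub> enc h = enc (g + h)"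
  by (simp_all add: Gamma_def)

lemma group_Gamma: "group Gamma"
proof (rule groupI; (unfold carrier_Gamma one_Gamma)?)
  fix x y
  assume "x \<in> enc ` Gam" "y \<in> enc ` Gam"
  then show "x \<otimes>\<^bsub>Gamma\<^esub> y \<in> enc ` Gam" by (auto simp: mult_Gamma Gam_add)
next
  fix x y z
  assume "x \<in> enc ` Gam" "y \<in> enc ` Gam" "z \<in> enc ` Gam"
  then show "x \<otimes>\<^bsub>Gamma\<^esub> y \<otimes>\<^bsub>Gamma\<^esub> z = x \<otimes>\<^bsub>Gamma\<^esub> (y \<otimes>\<^bsub>Gamma\<^esub> z)"
    by (auto simp: mult_Gamma Gam_add add.assoc)
next
  fix x
  assume "x \<in> enc ` Gam"
  then obtain g where g: "x = enc g" "g \<in> Gam" by blast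
  show "enc 0 \<otimes>\<^bsub>Gamma\<^esub> x = x" using g by (simp add: mult_Gamma)
  have "enc (- g) \<otimes>\<^bsub>Gamma\<^esub> x = enc 0" using g by (simp add: mult_Gamma Gam_uminus)
  then show "\<exists>y \<in> enc ` Gam. y \<otimes>\<^bsub>Gamma\<^esub> x = enc 0" using g Gam_uminus by blast
qed simp

lemma inv_Gamma:
  assumes "g \<in> Gam"
  shows "inv\<^bsub>Gamma\<^esub> enc g = enc (- g)"
  using assms by (intro group.inv_equality [OF group_Gamma])
    (auto simp: mult_Gamma Gam_uminus one_Gamma carrier_Gamma)

lemma foldr_Gamma:
  assumes "set gs \<subseteq> Gam"
  shows "foldr (\<otimes>\<^bsub>Gamma\<^esub>) (map enc gs) \<one>\<^bsub>Gamma\<^esub> = enc (sum_list gs) \<and> sum_list gs \<in> Gam"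
  using assms by (induction gs) (auto simp: one_Gamma mult_Gamma Gam_add)

lemma pow_Gamma:
  assumes "g \<in> Gam"
  shows "enc g [^]\<^bsub>Gamma\<^esub> (n :: nat) = enc (multiple g n) \<and> multiple g n \<in> Gam"
proof (induction n)
  case 0
  then show ?case using group.is_monoid [OF group_Gamma] by (simp add: one_Gamma monoid.nat_pow_0)
next
  case (Suc n)
  then show ?case
    using group.is_monoid [OF group_Gamma] assms by (simp add: monoid.nat_pow_Suc mult_Gamma Gam_add)
qed

lemma torsion_free_Gamma: "torsion_free Gamma"
  unfolding torsion_free_def carrier_Gamma one_Gamma
proof (intro ballI allI impI)
  fix x and n :: nat
  assume "x \<in> enc ` Gam" and n: "n > 0 \<and> x [^]\<^bsub>Gamma\<^esub> n = enc 0"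
  then obtain g where g: "x = enc g" "g \<in> Gam" by blast
  then have "multiple g n = 0"
    using pow_Gamma [OF g(2), of n] n enc_eq_iff [of "multiple g n" 0] by simp
  then show "x = enc 0" using portrait_torsion_free n g by blast
qed

section \<open>Generators, word length and growth of the transported group\<close>

definition gens :: "nat set" where
  "gens = enc ` letter ` (UNIV \<times> basis)"

lemma finite_gens: "finite gens"
  unfolding gens_def by (intro finite_imageI finite_cartesian_product finite_basis finite_UNIV)

lemma signed_gens: "gens \<union> m_inv Gamma ` gens = enc ` letter ` (UNIV \<times> signed_basis)"
proof -
  have "m_inv Gamma ` gens = enc ` uminus ` letter ` (UNIV \<times> basis)"
    unfolding gens_def image_image by (intro image_cong refl inv_Gamma Gam_letter)
  also have "uminus ` letter ` (UNIV \<times> basis) = letter ` (UNIV \<times> uminus ` basis)"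
  proof (intro equalityI subsetI)
    fix g
    assume "g \<in> uminus ` letter ` (UNIV \<times> basis)"
    then obtain b h where "g = - letter (b, h)" "h \<in> basis" by blast
    then show "g \<in> letter ` (UNIV \<times> uminus ` basis)" unfolding letter_uminus by blast
  next
    fix g
    assume "g \<in> letter ` (UNIV \<times> uminus ` basis)"
    then obtain b h where "g = letter (b, - h)" "h \<in> basis" by blast
    then show "g \<in> uminus ` letter ` (UNIV \<times> basis)" unfolding letter_uminus [symmetric] by blast
  qed
  finally show ?thesis
    by (simp add: gens_def signed_basis_def Sigma_Un_distrib2 image_Un)
qed

lemma word_Gamma:
  assumes "g \<in> Gam"
  shows "(\<exists>ws. length ws = k \<and> set ws \<subseteq> gens \<union> m_inv Gamma ` gens \<and>
        foldr (\<otimes>\<^bsub>Gamma\<^esub>) ws \<one>\<^bsub>Gamma\<^esub> = enc g) \<longleftrightarrow>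
    (\<exists>ws. length ws = k \<and> set ws \<subseteq> UNIV \<times> signed_basis \<and> eval_word ws = g)"
    (is "?L \<longleftrightarrow> ?R")
proof
  assume ?L
  then obtain ws where ws: "length ws = k" "set ws \<subseteq> enc ` letter ` (UNIV \<times> signed_basis)"
    "foldr (\<otimes>\<^bsub>Gamma\<^esub>) ws \<one>\<^bsub>Gamma\<^esub> = enc g"
    unfolding signed_gens by blast
  have "ws \<in> lists ((enc \<circ> letter) ` (UNIV \<times> signed_basis))"
    using ws(2) by (auto simp: image_comp)
  then obtain vs where vs: "vs \<in> lists (UNIV \<times> signed_basis)" "ws = map (enc \<circ> letter) vs"
    unfolding lists_image by blast
  have sub: "set (map letter vs) \<subseteq> Gam" using Gam_letter by auto
  have "eval_word vs = g"
    using foldr_Gamma [OF sub] ws(3) vs(2) enc_eq_iff assms by auto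
  then show ?R using vs ws(1) by (intro exI [of _ vs]) auto
next
  assume ?R
  then obtain vs where vs: "length vs = k" "set vs \<subseteq> UNIV \<times> signed_basis" "eval_word vs = g" by blast
  have sub: "set (map letter vs) \<subseteq> Gam" using Gam_letter by auto
  show ?L
    unfolding signed_gens
    using foldr_Gamma [OF sub] vs by (intro exI [of _ "map enc (map letter vs)"]) auto
qed

lemma word_length_Gamma:
  assumes "g \<in> Gam"
  shows "word_length Gamma gens (enc g) \<le> n \<longleftrightarrow> g \<in> word_ball n"
proof -
  define P where "P = (\<lambda>k. \<exists>ws. length ws = k \<and> set ws \<subseteq> UNIV \<times> signed_basis \<and> eval_word ws = g)"
  have len: "word_length Gamma gens (enc g) = (LEAST k. P k)"
    unfolding word_length_def word_Gamma [OF assms] P_def ..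
  have ball: "g \<in> word_ball n \<longleftrightarrow> (\<exists>k \<le> n. P k)" for n
    unfolding word_ball_def P_def by blast
  \<comment> \<open>Existence of some word ensures that \<open>LEAST\<close> is attained and not an
    unspecified value.\<close>
  then have "\<exists>k. P k" using Gam_word_ball [OF assms] by blast
  then have "P (LEAST k. P k)" by (rule LeastI_ex)
  then show ?thesis
    unfolding len ball by (meson Least_le order_trans)
qed

lemma growth_Gamma: "growth Gamma gens n = card (word_ball n)"
proof -
  have "{x \<in> carrier Gamma. word_length Gamma gens x \<le> n} = enc ` word_ball n"
    using word_length_Gamma word_ball_subset_Gam [of n] by (auto simp: carrier_Gamma)
  then show ?thesis
    using inj_on_subset [OF inj_enc word_ball_subset_Gam [of n]]
    by (simp add: growth_def card_image)
qed

lemma generating_set_Gamma: "generating_set Gamma gens"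
proof -
  have sub: "gens \<subseteq> carrier Gamma"
    unfolding gens_def carrier_Gamma using Gam_letter by blast
  have letter: "enc l \<in> generate Gamma gens" if "l \<in> letter ` (UNIV \<times> signed_basis)" for l
  proof -
    have "enc l \<in> gens \<union> m_inv Gamma ` gens"
      unfolding signed_gens using that by blast
    then show ?thesis by (auto intro: generate.intros)
  qed
  have "enc (eval_word ws) \<in> generate Gamma gens" if "set ws \<subseteq> UNIV \<times> signed_basis" for ws
    using that
  proof (induction ws)
    case Nil
    show ?case using generate.one [of Gamma gens] by (simp add: one_Gamma)
  next
    case (Cons l ws)
    have "enc (eval_word (l # ws)) = enc (letter l) \<otimes>\<^bsub>Gamma\<^esub> enc (eval_word ws)"
      using mult_Gamma [OF Gam_letter, of "eval_word ws" l] by (simp add: Gam_def)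
    then show ?case
      using Cons letter [of "letter l"] by (auto intro: generate.eng)
  qed
  then have "carrier Gamma \<subseteq> generate Gamma gens"
    unfolding carrier_Gamma using Gam_word_ball by (fastforce simp: word_ball_def)
  moreover have "generate Gamma gens \<subseteq> carrier Gamma"
    by (rule group.generate_incl [OF group_Gamma sub])
  ultimately show ?thesis
    using sub by (auto simp: generating_set_def)
qed

lemma intermediate_growth_Gamma: "intermediate_growth Gamma"
  unfolding intermediate_growth_def
  using finite_gens generating_set_Gamma word_ball_root word_ball_superpolynomial
  by (intro exI [of _ gens]) (simp add: growth_Gamma)

section \<open>The center as a direct sum of infinite cyclic groups\<close>

lemma center_Gamma: "center Gamma = enc ` level_const ` {f. finite {n. f n \<noteq> 0}}"
proof -
  have "center Gamma = enc ` {z \<in> Gam. \<forall>g \<in> Gam. z + g = g + z}"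
    by (auto simp: center_def carrier_Gamma mult_Gamma enc_eq_iff Gam_add)
  then show ?thesis by (simp add: center_Gam)
qed

lemma carrier_Z_infinity: "carrier Z_infinity = {f. finite {n. f n \<noteq> 0}}"
  unfolding Z_infinity_def by (subst carrier_sum_group) simp_all

lemma mult_Z_infinity: "f \<otimes>\<^bsub>Z_infinity\<^esub> g = (\<lambda>n. f n + g n)"
  by (simp add: Z_infinity_def restrict_def)

lemma center_iso: "center_group Gamma \<cong> Z_infinity"
proof -
  \<comment> \<open>Decoding a central element and reading its labels along one ray recovers its
    level function.\<close>
  let ?h = "\<lambda>a n. spine n (dec a)"
  have h: "?h (enc (level_const f)) = f" if "finite {n. f n \<noteq> 0}" for f
    using that by (simp add: level_const_Gam)
  have carrier: "carrier (center_group Gamma) = enc ` level_const ` {f. finite {n. f n \<noteq> 0}}"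
    by (simp add: center_group_def center_Gamma)
  have "?h \<in> iso (center_group Gamma) Z_infinity"
  proof (rule isoI)
    show "?h \<in> hom (center_group Gamma) Z_infinity"
    proof (rule homI)
      fix x y
      assume "x \<in> carrier (center_group Gamma)" "y \<in> carrier (center_group Gamma)"
      then obtain f g where fg: "x = enc (level_const f)" "finite {n. f n \<noteq> 0}"
        "y = enc (level_const g)" "finite {n. g n \<noteq> 0}" unfolding carrier by blast
      have fin: "finite {n. f n + g n \<noteq> 0}"
        by (rule finite_subset [OF _ finite_UnI [OF fg(2,4)]]) auto
      have "x \<otimes>\<^bsub>center_group Gamma\<^esub> y = enc (level_const (\<lambda>n. f n + g n))"
        using fg by (simp add: center_group_def mult_Gamma level_const_Gam level_const_add)
      then show "?h (x \<otimes>\<^bsub>center_group Gamma\<^esub> y) = ?h x \<otimes>\<^bsub>Z_infinity\<^esub> ?h y"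
        using fg h fin by (simp only: mult_Z_infinity)
    qed (auto simp: carrier carrier_Z_infinity level_const_Gam)
    show "bij_betw ?h (carrier (center_group Gamma)) (carrier Z_infinity)"
      unfolding carrier carrier_Z_infinity
      by (rule bij_betw_byWitness [where f' = "\<lambda>f. enc (level_const f)"]) (auto simp: level_const_Gam)
  qed
  then show ?thesis by (auto simp: is_iso_def)
qed

theorem theorem1p3:
  shows "\<exists>\<Gamma> :: nat monoid.
           group \<Gamma> \<and> finitely_generated \<Gamma> \<and> torsion_free \<Gamma> \<and> intermediate_growth \<Gamma> \<and>
           center_group \<Gamma> \<cong> Z_infinity"
  using group_Gamma finite_gens generating_set_Gamma torsion_free_Gamma
    intermediate_growth_Gamma center_iso
  unfolding finitely_generated_def by blast

end
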